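(* Let $\{X_t\}_{0\le t\le T}\sim\mathrm{EML}(\alpha,\lambda,b,T)$ and $\{X_t^*\}_{t\ge0}\sim\mathrm{EML}^*(\alpha,\lambda)$, and let $Y(t)$ be a Lévy process with characteristic function $\mathrm E(e^{\mathrm i sY(t)})=e^{t\psi(s)}$. Put $Z_t=Y(X_t)$ and $Z_t^*=Y(X_t^* )$. Then the characteristic functions of the finite-dimensional distributions of the subordinated processes $Z_t$, $Z_t^*$ are, for any $m\in\mathbb N$, $s_1,\dots,s_m\in\mathbb R$, and $S_i=\sum_{j=i}^ms_j$: for $0<t_1<\cdots<t_m\le T$, $$\mathrm E\big(e^{\mathrm i s_1Z_{t_1}+\cdots+\mathrm i s_mZ_{t_m}}\big)=m\big((\psi(S_1),\dots,\psi(S_m)),(t_1,\dots,t_m)\big),$$ and for $0<t_1<\cdots<t_m$, $$\mathrm E\big(e^{\mathrm i s_1Z^*_{t_1}+\cdots+\mathrm i s_mZ^*_{t_m}}\big)=m^*\big((\psi(S_1),\dots,\psi(S_m)),(t_1,\dots,t_m)\big),$$ where $m$ and $m^*$ are the functions given by the series in the context (evaluated at complex arguments).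
   Context: Parameters: $T>0$, $\alpha\in(0,1]$, $\lambda>(\alpha-1)/T$, $b\in(0,1]$. Put $c=1/\Gamma(\alpha)$, $a_T=b\,e^{-\lambda T}T^{\alpha-1}/\Gamma(\alpha)$, and $t_0=0$; $\mathbb N=\{1,2,\dots\}$. For $u=(u_1,\dots,u_m)\in\mathbb C^m$ and $0<t_1<\cdots<t_m$ define $$m(u,(t_1,\dots,t_m))=1+a_T\sum_{\emptyset\ne C\subset\{1,\dots,m\}}\sum_{k_1,\dots,k_{|C|}\in\mathbb N}t_{C(|C|)}^{\alpha(\sum_ik_i-1)+1}\Big(\prod_{i=1}^{|C|}u_{C(i)}^{k_i}\Big)A(C,\{k_i\}),$$ $$m^*(u,(t_1,\dots,t_m))=1+\sum_{\emptyset\ne C\subset\{1,\dots,m\}}\sum_{k_1,\dots,k_{|C|}\in\mathbb N}t_{C(|C|)}^{\alpha\sum_ik_i}\Big(\prod_{i=1}^{|C|}u_{C(i)}^{k_i}\Big)A^*(C,\{k_i\}),$$ where $C(i)$ is the $i$-th smallest element of $C$ and, with $q=|C|$, $\tau=t_{C(q)}$, $C_1=\{i\le q:k_i=1\}$, $C_2=\{i\le q:k_i\ge2\}$, $$A(C,\{k_i\})=\int_{Q_C}\Big\{\tfrac{(x_1-x_1')^{\alpha(k_1-1)-1}}{\Gamma((k_1-1)\alpha)}e^{-\lambda\tau(x_1-x_1')}\Big\}^{I(k_1>1)}\prod_{i\in C_2,i\ge2}\Big\{c(x_i'-x_{i-1})^{\alpha-1}\tfrac{(x_i-x_i')^{\alpha(k_i-1)-1}}{\Gamma((k_i-1)\alpha)}\Big\}\prod_{j\in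 C_1,j\ge2}\{c(x_j-x_{j-1})^{\alpha-1}\}\,e^{-\lambda\tau(x_q-x_1)}\,dx'\,dx,$$ $$A^*(C,\{k_i\})=\int_{Q_C}\prod_{i\in C_2}\Big\{c(x_i'-x_{i-1})^{\alpha-1}\tfrac{(x_i-x_i')^{\alpha(k_i-1)-1}}{\Gamma((k_i-1)\alpha)}\Big\}\prod_{j\in C_1}\{c(x_j-x_{j-1})^{\alpha-1}\}\,e^{-\lambda\tau x_q}\,dx'\,dx\quad(x_0=0),$$ with $I(\cdot)$ the indicator, integrating over $Q_C$: $t_{C(i)-1}/\tau<x_i'<x_i<t_{C(i)}/\tau$ for $i\in C_2$, $t_{C(j)-1}/\tau<x_j<t_{C(j)}/\tau$ for $j\in C_1$ ($t_{C(i)-1}$ is $t_r$ with $r=C(i)-1$; $dx'\,dx=\prod_{i\in C_2}dx_i'\prod_{\ell\le q}dx_\ell$). EML$(\alpha,\lambda,b,T)$ is the process $X$ on $[0,T]$ with $\mathrm E(e^{\sum_js_jX_{t_j}})=m((S_1,\dots,S_m),(t_1,\dots,t_m))$ for real $s_j$, $S_i=\sum_{j\ge i}s_j$, $0<t_1<\cdots<t_m\le T$. EML$^*(\alpha,\lambda)$ is the process $X^*$ on $[0,\infty)$ with $\mathrm E(e^{\sum_js_jX^*_{t_j}})=m^*((S_1,\dots,S_m),(t_1,\dots,t_m))$ for $0<t_1<\cdots<t_m$. Both start at $0$ and arise as scaling limits of nonnegative, nondecreasing partial-sum processes of dependent $\{0,1\}$-valued sequences. *)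

theory Defs
  imports "HOL-Probability.Probability"
begin

text \<open>
  Tuples are functions on \<^typ>\<open>nat\<close>, read at the indices \<open>1..m\<close>. A tuple of times is also read at
  index \<open>0\<close>, where the convention is \<open>t 0 = 0\<close>; it is part of \<open>time_points\<close> below.
\<close>

definition time_points :: "nat \<Rightarrow> (nat \<Rightarrow> real) \<Rightarrow> bool" where
  "time_points m t \<longleftrightarrow> t 0 = 0 \<and> strict_mono_on {0..m} t"

definition nth_smallest :: "nat set \<Rightarrow> nat \<Rightarrow> nat" where
  "nth_smallest C i = sorted_list_of_set C ! (i - 1)"

definition last_time :: "(nat \<Rightarrow> real) \<Rightarrow> nat set \<Rightarrow> real" where
  "last_time t C = t (nth_smallest C (card C))"

definition C1 :: "nat set \<Rightarrow> (nat \<Rightarrow> nat) \<Rightarrow> nat set" where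
  "C1 C k = {i \<in> {1..card C}. k i = 1}"

definition C2 :: "nat set \<Rightarrow> (nat \<Rightarrow> nat) \<Rightarrow> nat set" where
  "C2 C k = {i \<in> {1..card C}. k i \<ge> 2}"

definition multi_indices :: "nat set \<Rightarrow> (nat \<Rightarrow> nat) set" where
  "multi_indices C = {1..card C} \<rightarrow>\<^sub>E {1..}"

text \<open>
  The integration variables are pairs \<open>(x', x)\<close>, with \<open>x'\<close> indexed by \<^term>\<open>C2 C k\<close> only and
  \<open>x\<close> indexed by \<open>{1..card C}\<close>.
\<close>

definition var_measure :: "nat set \<Rightarrow> (nat \<Rightarrow> nat) \<Rightarrow> ((nat \<Rightarrow> real) \<times> (nat \<Rightarrow> real)) measure" where
  "var_measure C k = PiM (C2 C k) (\<lambda>_. lborel) \<Otimes>\<^sub>M PiM {1..card C} (\<lambda>_. lborel)"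

definition Q_region ::
  "(nat \<Rightarrow> real) \<Rightarrow> nat set \<Rightarrow> (nat \<Rightarrow> nat) \<Rightarrow> ((nat \<Rightarrow> real) \<times> (nat \<Rightarrow> real)) set" where
  "Q_region t C k = {(x', x).
     (\<forall>i\<in>C2 C k. t (nth_smallest C i - 1) / last_time t C < x' i \<and> x' i < x i \<and>
                  x i < t (nth_smallest C i) / last_time t C) \<and>
     (\<forall>j\<in>C1 C k. t (nth_smallest C j - 1) / last_time t C < x j \<and>
                  x j < t (nth_smallest C j) / last_time t C)}"

definition A_coeff ::
  "real \<Rightarrow> real \<Rightarrow> (nat \<Rightarrow> real) \<Rightarrow> nat set \<Rightarrow> (nat \<Rightarrow> nat) \<Rightarrow> real" where
  "A_coeff \<alpha> lam t C k =
     (let q = card C; \<tau> = last_time t C; c = 1 / Gamma \<alpha> in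
      set_lebesgue_integral (var_measure C k) (Q_region t C k) (\<lambda>(x', x).
        (if k 1 > 1
         then (x 1 - x' 1) powr (\<alpha> * (real (k 1) - 1) - 1) / Gamma ((real (k 1) - 1) * \<alpha>)
              * exp (- lam * \<tau> * (x 1 - x' 1))
         else 1)
        * (\<Prod>i\<in>{i \<in> C2 C k. i \<ge> 2}.
             c * (x' i - x (i - 1)) powr (\<alpha> - 1)
             * ((x i - x' i) powr (\<alpha> * (real (k i) - 1) - 1) / Gamma ((real (k i) - 1) * \<alpha>)))
        * (\<Prod>j\<in>{j \<in> C1 C k. j \<ge> 2}. c * (x j - x (j - 1)) powr (\<alpha> - 1))
        * exp (- lam * \<tau> * (x q - x 1))))"

definition prev :: "(nat \<Rightarrow> real) \<Rightarrow> nat \<Rightarrow> real" where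
  "prev x i = (if i = 1 then 0 else x (i - 1))"

definition A_star_coeff ::
  "real \<Rightarrow> real \<Rightarrow> (nat \<Rightarrow> real) \<Rightarrow> nat set \<Rightarrow> (nat \<Rightarrow> nat) \<Rightarrow> real" where
  "A_star_coeff \<alpha> lam t C k =
     (let q = card C; \<tau> = last_time t C; c = 1 / Gamma \<alpha> in
      set_lebesgue_integral (var_measure C k) (Q_region t C k) (\<lambda>(x', x).
        (\<Prod>i\<in>C2 C k.
             c * (x' i - prev x i) powr (\<alpha> - 1)
             * ((x i - x' i) powr (\<alpha> * (real (k i) - 1) - 1) / Gamma ((real (k i) - 1) * \<alpha>)))
        * (\<Prod>j\<in>C1 C k. c * (x j - prev x j) powr (\<alpha> - 1))
        * exp (- lam * \<tau> * x q)))"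

definition a_T :: "real \<Rightarrow> real \<Rightarrow> real \<Rightarrow> real \<Rightarrow> real" where
  "a_T \<alpha> lam b T = b * exp (- lam * T) * T powr (\<alpha> - 1) / Gamma \<alpha>"

definition m_EML ::
  "real \<Rightarrow> real \<Rightarrow> real \<Rightarrow> real \<Rightarrow> nat \<Rightarrow> (nat \<Rightarrow> complex) \<Rightarrow> (nat \<Rightarrow> real) \<Rightarrow> complex" where
  "m_EML \<alpha> lam b T m u t =
     1 + of_real (a_T \<alpha> lam b T) *
       (\<Sum>C\<in>{C. C \<subseteq> {1..m} \<and> C \<noteq> {}}. \<Sum>\<^sub>\<infinity>k\<in>multi_indices C.
          of_real (last_time t C powr (\<alpha> * (real (\<Sum>i=1..card C. k i) - 1) + 1))
          * (\<Prod>i=1..card C. u (nth_smallest C i) ^ k i)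
          * of_real (A_coeff \<alpha> lam t C k))"

definition m_EML_star ::
  "real \<Rightarrow> real \<Rightarrow> nat \<Rightarrow> (nat \<Rightarrow> complex) \<Rightarrow> (nat \<Rightarrow> real) \<Rightarrow> complex" where
  "m_EML_star \<alpha> lam m u t =
     1 + (\<Sum>C\<in>{C. C \<subseteq> {1..m} \<and> C \<noteq> {}}. \<Sum>\<^sub>\<infinity>k\<in>multi_indices C.
          of_real (last_time t C powr (\<alpha> * real (\<Sum>i=1..card C. k i)))
          * (\<Prod>i=1..card C. u (nth_smallest C i) ^ k i)
          * of_real (A_star_coeff \<alpha> lam t C k))"

context prob_space
begin

text \<open>
  A \<open>[0,\<infinity>)\<close>-valued process that starts at \<open>0\<close> and is nondecreasing. The last
  two properties are only required almost surely, for each (pair of) time(s), because this is what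
  passes to a limit of finite-dimensional distributions. Nonnegativity is sure, so that the values
  are always admissible as times of another process.
\<close>

definition time_change :: "real set \<Rightarrow> (real \<Rightarrow> 'a \<Rightarrow> real) \<Rightarrow> bool" where
  "time_change I X \<longleftrightarrow>
     (\<forall>t\<in>I. random_variable borel (X t)) \<and>
     (\<forall>t\<in>I. \<forall>\<omega>\<in>space M. 0 \<le> X t \<omega>) \<and>
     (AE \<omega> in M. X 0 \<omega> = 0) \<and>
     (\<forall>s\<in>I. \<forall>t\<in>I. s \<le> t \<longrightarrow> (AE \<omega> in M. X s \<omega> \<le> X t \<omega>))"

text \<open>
  Integrability is stated separately because the Bochner integral of a non-integrable function
  is \<open>0\<close> rather than \<open>\<infinity>\<close>.
\<close>

definition EML :: "real \<Rightarrow> real \<Rightarrow> real \<Rightarrow> real \<Rightarrow> (real \<Rightarrow> 'a \<Rightarrow> real) \<Rightarrow> bool" where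
  "EML \<alpha> lam b T X \<longleftrightarrow>
     time_change {0..T} X \<and>
     (\<forall>m\<ge>1. \<forall>s t. time_points m t \<and> t m \<le> T \<longrightarrow>
        integrable M (\<lambda>\<omega>. exp (\<Sum>j=1..m. s j * X (t j) \<omega>)) \<and>
        of_real (expectation (\<lambda>\<omega>. exp (\<Sum>j=1..m. s j * X (t j) \<omega>)))
          = m_EML \<alpha> lam b T m (\<lambda>i. of_real (\<Sum>j=i..m. s j)) t)"

definition EML_star :: "real \<Rightarrow> real \<Rightarrow> (real \<Rightarrow> 'a \<Rightarrow> real) \<Rightarrow> bool" where
  "EML_star \<alpha> lam X \<longleftrightarrow>
     time_change {0..} X \<and>
     (\<forall>m\<ge>1. \<forall>s t. time_points m t \<longrightarrow>
        integrable M (\<lambda>\<omega>. exp (\<Sum>j=1..m. s j * X (t j) \<omega>)) \<and>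
        of_real (expectation (\<lambda>\<omega>. exp (\<Sum>j=1..m. s j * X (t j) \<omega>)))
          = m_EML_star \<alpha> lam m (\<lambda>i. of_real (\<Sum>j=i..m. s j)) t)"

text \<open>
  Real-valued Levy processes on \<open>[0,\<infinity>)\<close>: null at \<open>0\<close>, independent and stationary increments,
  continuous in probability, cadlag paths. The last condition is imposed on every path: an
  exceptional null set could make \<open>Y (X t \<omega>) \<omega>\<close> non-measurable when \<^term>\<open>M\<close> is not complete.
\<close>

definition levy_process :: "(real \<Rightarrow> 'a \<Rightarrow> real) \<Rightarrow> bool" where
  "levy_process Y \<longleftrightarrow>
     (\<forall>t\<ge>0. random_variable borel (Y t)) \<and>
     (AE \<omega> in M. Y 0 \<omega> = 0) \<and>
     (\<forall>n t. 0 \<le> t 0 \<and> strict_mono_on {0..n} t \<longrightarrow>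
        indep_vars (\<lambda>_. borel) (\<lambda>i \<omega>. Y (t (Suc i)) \<omega> - Y (t i) \<omega>) {..<n}) \<and>
     (\<forall>s\<ge>0. \<forall>h\<ge>0. distr M borel (\<lambda>\<omega>. Y (s + h) \<omega> - Y s \<omega>) = distr M borel (Y h)) \<and>
     (\<forall>t\<ge>0. \<forall>\<epsilon>>0.
        ((\<lambda>s. prob {\<omega> \<in> space M. \<bar>Y s \<omega> - Y t \<omega>\<bar> > \<epsilon>}) \<longlongrightarrow> 0) (at t within {0..})) \<and>
     (\<forall>\<omega>\<in>space M.
        (\<forall>t\<ge>0. continuous (at_right t) (\<lambda>s. Y s \<omega>)) \<and>
        (\<forall>t>0. \<exists>l. ((\<lambda>s. Y s \<omega>) \<longlongrightarrow> l) (at_left t)))"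

definition indep_processes ::
  "real set \<Rightarrow> (real \<Rightarrow> 'a \<Rightarrow> real) \<Rightarrow> real set \<Rightarrow> (real \<Rightarrow> 'a \<Rightarrow> real) \<Rightarrow> bool" where
  "indep_processes I X J Y \<longleftrightarrow>
     indep_var (PiM I (\<lambda>_. borel)) (\<lambda>\<omega>. \<lambda>t\<in>I. X t \<omega>) (PiM J (\<lambda>_. borel)) (\<lambda>\<omega>. \<lambda>t\<in>J. Y t \<omega>)"

end

definition subordinated :: "(real \<Rightarrow> 'a \<Rightarrow> real) \<Rightarrow> (real \<Rightarrow> 'a \<Rightarrow> real) \<Rightarrow> real \<Rightarrow> 'a \<Rightarrow> real" where
  "subordinated Y X t \<omega> = Y (X t \<omega>) \<omega>"

end

theory Submission
  imports Defs "HOL-Complex_Analysis.Cauchy_Integral_Formula"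
begin

text \<open>
  Write \<open>S\<^sub>i = s\<^sub>i + \<dots> + s\<^sub>m\<close> and \<open>D\<^sub>i = X(t\<^sub>i) - X(t\<^bsub>i-1\<^esub>) \<ge> 0\<close>. Conditioning on \<open>X\<close> gives
  \<open>E exp(\<i> \<Sum> s\<^sub>j Z(t\<^sub>j)) = E exp(\<Sum> \<psi>(S\<^sub>i) D\<^sub>i)\<close>. As evaluation \<open>(x, y) \<mapsto> y x\<close> is not measurable for
  the product sigma-algebra, Fubini is applied to random times rounded up to a grid; right-continuity
  of the paths of \<open>Y\<close> and dominated convergence then remove the rounding.

  It remains to pass from real to complex \<open>u\<close> in \<open>E exp(\<Sum> u\<^sub>i D\<^sub>i) = m(u, t)\<close>. The left-hand side is the
  sum over \<open>C\<close> of \<open>E \<Prod>\<^bsub>i\<in>C\<^esub> (exp(u\<^sub>i D\<^sub>i) - 1)\<close>, an everywhere convergent power series whose exponents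
  on \<open>C\<close> are all positive. Setting the other variables to \<open>0\<close> matches the summands for each \<open>C\<close>
  separately. No estimate of the coefficients \<open>A(C, k)\<close> is needed: if the series for \<open>C\<close> converges
  at one point without zero coordinates, uniqueness of power series identifies its coefficients;
  otherwise its value is by convention \<open>0\<close> at every real and every complex point, so that the
  expectation vanishes at all real points and hence identically.
\<close>

section \<open>Uniqueness of multivariate power series\<close>

text \<open>A nonzero power series without constant term has no zeros in some punctured disc around
  0 (\<open>powser_0_nonzero\<close>), whereas here the zeros fill a real segment ending at 0. Hence
  values at nonnegative real points suffice.\<close>

lemma powser_uniqueness_real:
  fixes a :: "nat \<Rightarrow> complex"
  assumes "r > 0" and sm: "(\<lambda>n. a n * of_real r ^ n) summable_on UNIV"
    and zero: "\<And>x::real. 0 \<le> x \<Longrightarrow> x \<le> r \<Longrightarrow> (\<Sum>\<^sub>\<infinity>n. a n * of_real x ^ n) = 0"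
  shows "a n = 0"
proof (rule ccontr)
  assume an: "a n \<noteq> 0"
  have "summable (\<lambda>n. a n * of_real r ^ n)"
    using sm by (rule summable_on_imp_summable)
  \<comment> \<open>Absolute convergence is derived in the open disc only, so from here on just the
    points strictly below \<open>r\<close> are used.\<close>
  then have norm_sm: "summable (\<lambda>n. norm (a n * z ^ n))" if "norm z < r" for z :: complex
    using that \<open>r > 0\<close> by (intro powser_insidea[of a "of_real r"]) auto
  define f where "f z = (\<Sum>n. a n * z ^ n)" for z :: complex
  have sums: "(\<lambda>n. a n * (z - 0) ^ n) sums f z" if "norm (z - 0) < r" for z
    using summable_norm_cancel[OF norm_sm[of z]] that by (simp add: f_def summable_sums)
  have f0: "f (of_real x) = 0" if "0 \<le> x" "x < r" for x
    using norm_summable_imp_has_sum[OF norm_sm[of "of_real x"] sums[of "of_real x", simplified]]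
      zero[of x] that by (auto dest!: infsumI)
  have "a 0 = 0"
    using f0[of 0] \<open>r > 0\<close> by (simp add: f_def)
  then have "n > 0"
    using an by (auto intro!: Nat.gr0I)
  then obtain s where s: "s > 0" "\<And>z. z \<in> cball 0 s - {0} \<Longrightarrow> f z \<noteq> 0"
    using powser_0_nonzero[OF \<open>r > 0\<close> sums _ an] f0[of 0] \<open>r > 0\<close> by auto
  \<comment> \<open>A positive real that lies both in the zero-free punctured disc and strictly
    inside the disc of convergence.\<close>
  define x where "x = min s (r / 2)"
  have "0 < x" "x < r" "x \<le> s" using \<open>r > 0\<close> \<open>s > 0\<close> by (auto simp: x_def)
  then show False using f0[of x] s(2)[of "of_real x"] by auto
qed

lemma PiE_UNIV_insert_bij:
  assumes "x \<notin> I"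
  shows "bij_betw (\<lambda>(n, k). k(x := n)) (UNIV \<times> PiE I (\<lambda>_. UNIV)) (PiE (insert x I) (\<lambda>_. UNIV))"
  unfolding bij_betw_def using inj_combinator[OF assms]
  by (auto simp: PiE_insert_eq)

text \<open>Induction on the set of variables. Summability at the corner of the cube dominates all
  its points, so the exponents of the old variables may be summed first. What remains is a series in
  the new variable whose coefficients vanish by the one-variable case; these are again power series,
  and the induction hypothesis applies to them.\<close>

lemma multi_powser_uniqueness_real:
  fixes d :: "('i \<Rightarrow> nat) \<Rightarrow> complex"
  assumes "finite I" "r > 0"
    and "(\<lambda>k. d k * (\<Prod>i\<in>I. of_real r ^ k i)) summable_on (I \<rightarrow>\<^sub>E UNIV)"
    and "\<And>u::'i \<Rightarrow> real. (\<And>i. i \<in> I \<Longrightarrow> 0 \<le> u i \<and> u i \<le> r) \<Longrightarrow>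
      (\<Sum>\<^sub>\<infinity>k\<in>I \<rightarrow>\<^sub>E UNIV. d k * (\<Prod>i\<in>I. of_real (u i) ^ k i)) = 0"
    and "k \<in> I \<rightarrow>\<^sub>E UNIV"
  shows "d k = 0"
  using assms
proof (induction I arbitrary: d k rule: finite_induct)
  case empty
  then show ?case by simp
next
  case (insert x I)
  let ?K = "I \<rightarrow>\<^sub>E (UNIV :: nat set)"
  note bij = PiE_UNIV_insert_bij[OF insert.hyps(2)]
  \<comment> \<open>The value \<open>v\<close> of the new variable is kept apart from
    \<open>u\<close>, so that it can vary while \<open>u\<close> is fixed.\<close>
  define G where "G v u n k = d (k(x := n)) * (\<Prod>i\<in>I. of_real (u i) ^ k i) * of_real v ^ n"
    for v :: real and u :: "'i \<Rightarrow> real" and n k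
  have G: "d (k(x := n)) * (\<Prod>i\<in>insert x I. of_real (u i) ^ (k(x := n)) i) = G (u x) u n k" for u n k
  proof -
    have "(\<Prod>i\<in>I. of_real (u i) ^ (k(x := n)) i) = (\<Prod>i\<in>I. of_real (u i) ^ k i :: complex)"
      by (rule prod.cong) (use insert.hyps in auto)
    then show ?thesis using insert.hyps by (simp add: G_def mult_ac)
  qed
  have summ_r: "(\<lambda>(n, k). G r (\<lambda>_. r) n k) summable_on UNIV \<times> ?K"
    using summable_on_reindex_bij_betw[OF bij, of "\<lambda>k. d k * (\<Prod>i\<in>insert x I. of_real r ^ k i)"]
      insert.prems(2) G[of _ _ "\<lambda>_. r"] by (simp add: case_prod_unfold)
  have summ: "(\<lambda>(n, k). G v u n k) summable_on UNIV \<times> ?K"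
    if "\<And>i. i \<in> I \<Longrightarrow> 0 \<le> u i \<and> u i \<le> r" "0 \<le> v" "v \<le> r" for v u
  proof -
    have le: "norm (case p of (n, k) \<Rightarrow> G v u n k) \<le> norm (case p of (n, k) \<Rightarrow> G r (\<lambda>_. r) n k)"
      for p
      unfolding G_def case_prod_unfold norm_mult
      by (intro mult_mono mult_left_mono)
        (use that \<open>r > 0\<close> in \<open>auto simp: norm_power prod_norm[symmetric]
           intro!: prod_mono power_mono prod_nonneg mult_nonneg_nonneg\<close>)
    show ?thesis
      unfolding summable_on_iff_abs_summable_on_complex
      by (rule Infinite_Sum.abs_summable_on_comparison_test
          [OF summ_r[unfolded summable_on_iff_abs_summable_on_complex] le])
  qed
  have zero: "d (k(x := n)) = 0" if "k \<in> ?K" for k n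
  proof (rule insert.IH[of "\<lambda>k. d (k(x := n))", OF \<open>r > 0\<close> _ _ that])
    \<comment> \<open>The slice at a fixed exponent \<open>n\<close> of the new variable; its
      constant factor \<open>r ^ n\<close> is nonzero and cancels.\<close>
    have "G r (\<lambda>_. r) n summable_on ?K"
      using summable_on_SigmaD1[OF summ_r, of n] by simp
    then show "(\<lambda>k. d (k(x := n)) * (\<Prod>i\<in>I. of_real r ^ k i)) summable_on ?K"
      using \<open>r > 0\<close> unfolding G_def by (subst (asm) summable_on_cmult_left') auto
  next
    fix u :: "'i \<Rightarrow> real" assume u: "\<And>i. i \<in> I \<Longrightarrow> 0 \<le> u i \<and> u i \<le> r"
    define a where "a n = (\<Sum>\<^sub>\<infinity>k\<in>?K. d (k(x := n)) * (\<Prod>i\<in>I. of_real (u i) ^ k i))" for n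
    have a: "(\<Sum>\<^sub>\<infinity>k\<in>?K. G v u n k) = a n * of_real v ^ n" for v n
      unfolding a_def G_def by (rule infsum_cmult_left')
    have "a n = 0"
    proof (rule powser_uniqueness_real[OF \<open>r > 0\<close>])
      show "(\<lambda>n. a n * of_real r ^ n) summable_on UNIV"
        using summable_on_Sigma_banach[OF summ[where u = u and v = r, OF u]] \<open>r > 0\<close> by (simp add: a)
    next
      fix v :: real assume v: "0 \<le> v" "v \<le> r"
      have "(\<Sum>\<^sub>\<infinity>n. a n * of_real v ^ n) = (\<Sum>\<^sub>\<infinity>n. \<Sum>\<^sub>\<infinity>k\<in>?K. G v u n k)"
        by (simp add: a)
      also have "\<dots> = (\<Sum>\<^sub>\<infinity>(n, k)\<in>UNIV \<times> ?K. G v u n k)"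
        using infsum_Sigma'_banach[OF summ[where u = u and v = v, OF u]] v by simp
      also have "\<dots> = (\<Sum>\<^sub>\<infinity>(n, k)\<in>UNIV \<times> ?K. G v (u(x := v)) n k)"
      proof -
        have "(\<Prod>i\<in>I. of_real ((u(x := v)) i) ^ k i) = (\<Prod>i\<in>I. of_real (u i) ^ k i :: complex)" for k
          by (rule prod.cong) (use insert.hyps in auto)
        then show ?thesis by (simp add: G_def)
      qed
      also have "\<dots> = (\<Sum>\<^sub>\<infinity>k\<in>insert x I \<rightarrow>\<^sub>E UNIV. d k * (\<Prod>i\<in>insert x I. of_real ((u(x := v)) i) ^ k i))"
        using infsum_reindex_bij_betw[OF bij,
            of "\<lambda>k. d k * (\<Prod>i\<in>insert x I. of_real ((u(x := v)) i) ^ k i)"]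
          G[of _ _ "u(x := v)"] by (simp add: case_prod_unfold del: fun_upd_apply prod.insert) simp
      also have "\<dots> = 0"
        by (rule insert.prems(3)) (use u v in auto)
      finally show "(\<Sum>\<^sub>\<infinity>n. a n * of_real v ^ n) = 0" .
    qed
    then show "(\<Sum>\<^sub>\<infinity>k\<in>?K. d (k(x := n)) * (\<Prod>i\<in>I. of_real (u i) ^ k i)) = 0"
      by (simp add: a_def)
  qed
  have "k \<in> (\<lambda>(n, k). k(x := n)) ` (UNIV \<times> ?K)"
    using insert.prems(4) by (simp only: bij_betw_imp_surj_on[OF bij])
  then obtain n k' where "k = k'(x := n)" "k' \<in> ?K" by auto
  then show ?case by (simp only: zero)
qed

text \<open>The hypotheses are asymmetric on purpose: \<open>p\<close> will consist of moments and
  converges everywhere, while nothing is known about convergence for \<open>c\<close>, so its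
  \<open>infsum\<close> may carry the default value 0.\<close>

lemma multi_powser_real_imp_complex:
  fixes p c :: "('i \<Rightarrow> nat) \<Rightarrow> complex" and v :: "'i \<Rightarrow> complex"
  defines "K \<equiv> \<lambda>I. I \<rightarrow>\<^sub>E {1..}"
  assumes "finite I"
    and sp: "\<And>v :: 'i \<Rightarrow> complex. (\<lambda>k. p k * (\<Prod>i\<in>I. v i ^ k i)) summable_on K I"
    and eq: "\<And>u :: 'i \<Rightarrow> real. (\<Sum>\<^sub>\<infinity>k\<in>K I. p k * (\<Prod>i\<in>I. of_real (u i) ^ k i)) =
      (\<Sum>\<^sub>\<infinity>k\<in>K I. c k * (\<Prod>i\<in>I. of_real (u i) ^ k i))"
  shows "(\<Sum>\<^sub>\<infinity>k\<in>K I. p k * (\<Prod>i\<in>I. v i ^ k i)) = (\<Sum>\<^sub>\<infinity>k\<in>K I. c k * (\<Prod>i\<in>I. v i ^ k i))"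
proof -
  have KU: "K I \<subseteq> I \<rightarrow>\<^sub>E UNIV" by (auto simp: K_def)
  \<comment> \<open>Every term contains every variable because all exponents are positive. The
    points with a zero coordinate therefore give 0 whatever the coefficients are.\<close>
  have vanish: "(\<Sum>\<^sub>\<infinity>k\<in>K I. d k * (\<Prod>i\<in>I. w i ^ k i)) = 0"
    if i: "i \<in> I" "w i = 0" for d and w :: "'i \<Rightarrow> complex" and i
  proof (rule infsum_0)
    fix k assume "k \<in> K I"
    then have "k i \<ge> 1" using i by (auto simp: K_def PiE_def Pi_def)
    then show "d k * (\<Prod>i\<in>I. w i ^ k i) = 0"
      using i \<open>finite I\<close> by (auto intro!: prod_zero bexI[of _ i])
  qed
  have unique: "\<forall>k\<in>K I. d k = 0"
    if "r > 0" and sd: "(\<lambda>k. d k * (\<Prod>i\<in>I. of_real r ^ k i)) summable_on K I"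
      and zd: "\<And>u :: 'i \<Rightarrow> real. (\<And>i. i \<in> I \<Longrightarrow> 0 \<le> u i \<and> u i \<le> r) \<Longrightarrow>
        (\<Sum>\<^sub>\<infinity>k\<in>K I. d k * (\<Prod>i\<in>I. of_real (u i) ^ k i)) = 0"
    for r :: real and d :: "('i \<Rightarrow> nat) \<Rightarrow> complex"
  proof
    fix k assume k: "k \<in> K I"
    \<comment> \<open>Extension by 0 from positive exponents to all exponents, where the uniqueness
      lemma is stated.\<close>
    define d' where "d' k = (if k \<in> K I then d k else 0)" for k
    have "d' k = 0"
    proof (rule multi_powser_uniqueness_real[OF \<open>finite I\<close> \<open>r > 0\<close>])
      show "(\<lambda>k. d' k * (\<Prod>i\<in>I. of_real r ^ k i)) summable_on (I \<rightarrow>\<^sub>E UNIV)"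
        by (rule summable_on_cong_neutral[THEN iffD1, OF _ _ _ sd]) (use KU in \<open>auto simp: d'_def\<close>)
    next
      fix u :: "'i \<Rightarrow> real" assume "\<And>i. i \<in> I \<Longrightarrow> 0 \<le> u i \<and> u i \<le> r"
      then have "(\<Sum>\<^sub>\<infinity>k\<in>K I. d k * (\<Prod>i\<in>I. of_real (u i) ^ k i)) = 0" by (rule zd)
      moreover have "(\<Sum>\<^sub>\<infinity>k\<in>I \<rightarrow>\<^sub>E UNIV. d' k * (\<Prod>i\<in>I. of_real (u i) ^ k i)) =
          (\<Sum>\<^sub>\<infinity>k\<in>K I. d k * (\<Prod>i\<in>I. of_real (u i) ^ k i))"
        by (rule infsum_cong_neutral) (use KU in \<open>auto simp: d'_def\<close>)
      ultimately show "(\<Sum>\<^sub>\<infinity>k\<in>I \<rightarrow>\<^sub>E UNIV. d' k * (\<Prod>i\<in>I. of_real (u i) ^ k i)) = 0" by simp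
    qed (use k KU in auto)
    then show "d k = 0" using k by (simp add: d'_def)
  qed
  show ?thesis
  proof (cases "\<exists>w. (\<forall>i\<in>I. w i \<noteq> 0) \<and> (\<lambda>k. c k * (\<Prod>i\<in>I. w i ^ k i)) summable_on K I")
    case True
    then obtain w where w: "\<And>i. i \<in> I \<Longrightarrow> w i \<noteq> 0"
      and sw: "(\<lambda>k. c k * (\<Prod>i\<in>I. w i ^ k i)) summable_on K I" by blast
    \<comment> \<open>The cube with this edge is dominated termwise by the point \<open>w\<close>;
      the entry 1 keeps \<open>Min\<close> meaningful when \<open>I\<close> is empty.\<close>
    define r where "r = Min (insert 1 ((\<lambda>i. norm (w i)) ` I))"
    have "r > 0" using \<open>finite I\<close> w by (auto simp: r_def)
    have rw: "r \<le> norm (w i)" if "i \<in> I" for i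
      using \<open>finite I\<close> that by (auto simp: r_def)
    have sc: "(\<lambda>k. c k * (\<Prod>i\<in>I. of_real (u i) ^ k i)) summable_on K I"
      if u: "\<And>i. i \<in> I \<Longrightarrow> 0 \<le> u i \<and> u i \<le> r" for u :: "'i \<Rightarrow> real"
      unfolding summable_on_iff_abs_summable_on_complex
    proof (rule Infinite_Sum.abs_summable_on_comparison_test
        [OF sw[unfolded summable_on_iff_abs_summable_on_complex]])
      fix k
      have "(\<Prod>i\<in>I. \<bar>u i\<bar> ^ k i) \<le> (\<Prod>i\<in>I. norm (w i) ^ k i)"
        using u rw by (intro prod_mono conjI power_mono) (force intro: order_trans)+
      then show "norm (c k * (\<Prod>i\<in>I. of_real (u i) ^ k i)) \<le> norm (c k * (\<Prod>i\<in>I. w i ^ k i))"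
        by (auto simp: norm_mult norm_power prod_norm[symmetric] intro!: mult_left_mono)
    qed
    have "\<forall>k\<in>K I. p k - c k = 0"
    proof (rule unique[OF \<open>r > 0\<close>])
      show "(\<lambda>k. (p k - c k) * (\<Prod>i\<in>I. of_real r ^ k i)) summable_on K I"
        using summable_on_add[OF sp[of "\<lambda>_. of_real r"] summable_on_uminus[THEN iffD2, OF sc[of "\<lambda>_. r"]]] \<open>r > 0\<close>
        by (simp add: left_diff_distrib)
    next
      fix u :: "'i \<Rightarrow> real" assume u: "\<And>i. i \<in> I \<Longrightarrow> 0 \<le> u i \<and> u i \<le> r"
      show "(\<Sum>\<^sub>\<infinity>k\<in>K I. (p k - c k) * (\<Prod>i\<in>I. of_real (u i) ^ k i)) = 0"
        using infsum_add[OF sp[of "\<lambda>i. of_real (u i)"] summable_on_uminus[THEN iffD2, OF sc[OF u]]]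
          eq[of u] by (simp add: left_diff_distrib infsum_uminus)
    qed
    then show ?thesis by (intro infsum_cong) auto
  next
    case False
    have c0: "(\<Sum>\<^sub>\<infinity>k\<in>K I. c k * (\<Prod>i\<in>I. w i ^ k i)) = 0" for w
    proof (cases "\<forall>i\<in>I. w i \<noteq> 0")
      case True
      with False show ?thesis by (intro infsum_not_exists) blast
    next
      case False
      then show ?thesis using vanish by blast
    qed
    \<comment> \<open>By \<open>eq\<close> and \<open>c0\<close> the series of \<open>p\<close> is 0
      at all real points; as it converges everywhere, any radius would do.\<close>
    have "\<forall>k\<in>K I. p k = 0"
      by (rule unique[of 1]) (use sp[of "\<lambda>_. 1"] eq c0 in auto)
    then have "(\<Sum>\<^sub>\<infinity>k\<in>K I. p k * (\<Prod>i\<in>I. v i ^ k i)) = 0"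
      by (intro infsum_0) auto
    then show ?thesis using c0 by simp
  qed
qed

section \<open>Expectations as power series\<close>

text \<open>One integrable bound on all finite partial sums of norms controls both the pointwise
  sums and the sum of the integrated norms, which is what termwise integration of a sequence
  requires.\<close>

lemma integral_infsum_interchange:
  fixes f :: "'i \<Rightarrow> 'a \<Rightarrow> complex"
  assumes "countable K"
    and int: "\<And>k. k \<in> K \<Longrightarrow> integrable M (f k)"
    and g: "integrable M g"
    and dom: "\<And>\<omega> F. \<omega> \<in> space M \<Longrightarrow> finite F \<Longrightarrow> F \<subseteq> K \<Longrightarrow> (\<Sum>k\<in>F. norm (f k \<omega>)) \<le> g \<omega>"
  shows "(\<lambda>k. \<integral>\<omega>. f k \<omega> \<partial>M) summable_on K"
    and "(\<Sum>\<^sub>\<infinity>k\<in>K. \<integral>\<omega>. f k \<omega> \<partial>M) = (\<integral>\<omega>. (\<Sum>\<^sub>\<infinity>k\<in>K. f k \<omega>) \<partial>M)"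
proof -
  define h where "h n \<omega> = (if n \<in> to_nat_on K ` K then f (from_nat_into K n) \<omega> else 0)" for n \<omega>
  have sum_h: "(\<Sum>n\<in>N. norm (h n \<omega>)) \<le> g \<omega>" if "\<omega> \<in> space M" "finite N" for \<omega> N
  proof -
    let ?N = "N \<inter> to_nat_on K ` K"
    have "(\<Sum>n\<in>N. norm (h n \<omega>)) = (\<Sum>n\<in>?N. norm (f (from_nat_into K n) \<omega>))"
      using \<open>finite N\<close> by (intro sum.mono_neutral_cong_right) (auto simp: h_def)
    also have "\<dots> = (\<Sum>k\<in>from_nat_into K ` ?N. norm (f k \<omega>))"
      using \<open>countable K\<close> by (subst sum.reindex) (auto simp: inj_on_def)
    also have "\<dots> \<le> g \<omega>"
      using that \<open>countable K\<close> by (intro dom) auto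
    finally show ?thesis .
  qed
  have int_h: "integrable M (h n)" for n
    using int \<open>countable K\<close> by (cases "n \<in> to_nat_on K ` K") (auto simp: h_def[abs_def])
  have norm_h: "(\<lambda>n. norm (h n \<omega>)) summable_on UNIV" if "\<omega> \<in> space M" for \<omega>
    using sum_h[OF that] by (intro nonneg_bdd_above_summable_on) (auto intro!: bdd_aboveI[of _ "g \<omega>"])
  have int_norm_h: "(\<lambda>n. \<integral>\<omega>. norm (h n \<omega>) \<partial>M) summable_on UNIV"
  proof (rule nonneg_bdd_above_summable_on)
    have "(\<Sum>n\<in>N. \<integral>\<omega>. norm (h n \<omega>) \<partial>M) \<le> (\<integral>\<omega>. g \<omega> \<partial>M)" if "finite N" for N
    proof -
      have "(\<Sum>n\<in>N. \<integral>\<omega>. norm (h n \<omega>) \<partial>M) = (\<integral>\<omega>. (\<Sum>n\<in>N. norm (h n \<omega>)) \<partial>M)"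
        using int_h by (intro Bochner_Integration.integral_sum[symmetric]) auto
      also have "\<dots> \<le> (\<integral>\<omega>. g \<omega> \<partial>M)"
        using int_h g sum_h that by (intro integral_mono) auto
      finally show ?thesis .
    qed
    then show "bdd_above (sum (\<lambda>n. \<integral>\<omega>. norm (h n \<omega>) \<partial>M) ` {N. N \<subseteq> UNIV \<and> finite N})"
      by (auto intro!: bdd_aboveI)
  qed auto
  have sums: "(\<lambda>n. \<integral>\<omega>. h n \<omega> \<partial>M) sums (\<integral>\<omega>. (\<Sum>n. h n \<omega>) \<partial>M)"
    using int_h norm_h[THEN summable_on_imp_summable] int_norm_h[THEN summable_on_imp_summable]
    by (intro sums_integral) auto
  \<comment> \<open>Absolute convergence turns the ordered sum into an unordered one, which can be
    carried back to \<open>K\<close>.\<close>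
  have "summable (\<lambda>n. norm (\<integral>\<omega>. h n \<omega> \<partial>M))"
    using int_norm_h[THEN summable_on_imp_summable]
    by (rule summable_comparison_test'[where N = 0]) auto
  then have hs: "((\<lambda>n. \<integral>\<omega>. h n \<omega> \<partial>M) has_sum (\<integral>\<omega>. (\<Sum>n. h n \<omega>) \<partial>M)) UNIV"
    using sums by (rule norm_summable_imp_has_sum)
  have "(\<Sum>n. h n \<omega>) = (\<Sum>\<^sub>\<infinity>k\<in>K. f k \<omega>)" if "\<omega> \<in> space M" for \<omega>
  proof -
    have "summable (\<lambda>n. norm (h n \<omega>))" using norm_h[OF that] by (rule summable_on_imp_summable)
    then have "(\<Sum>n. h n \<omega>) = (\<Sum>\<^sub>\<infinity>n. h n \<omega>)"
      using norm_summable_imp_has_sum[OF _ summable_sums] by (metis infsumI summable_norm_cancel)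
    also have "\<dots> = (\<Sum>\<^sub>\<infinity>n\<in>to_nat_on K ` K. h n \<omega>)"
      by (rule infsum_cong_neutral) (auto simp: h_def)
    also have "\<dots> = (\<Sum>\<^sub>\<infinity>k\<in>K. f k \<omega>)"
      using \<open>countable K\<close>
      by (subst infsum_reindex) (auto simp: h_def inj_on_to_nat_on intro!: infsum_cong)
    finally show ?thesis .
  qed
  then have eq: "(\<integral>\<omega>. (\<Sum>n. h n \<omega>) \<partial>M) = (\<integral>\<omega>. (\<Sum>\<^sub>\<infinity>k\<in>K. f k \<omega>) \<partial>M)"
    by (intro Bochner_Integration.integral_cong) auto
  have "((\<lambda>n. \<integral>\<omega>. h n \<omega> \<partial>M) has_sum (\<integral>\<omega>. (\<Sum>\<^sub>\<infinity>k\<in>K. f k \<omega>) \<partial>M)) (to_nat_on K ` K)"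
    using hs unfolding eq
    by (rule has_sum_cong_neutral[THEN iffD1, rotated -1]) (auto simp: h_def[abs_def])
  then have "(((\<lambda>n. \<integral>\<omega>. h n \<omega> \<partial>M) \<circ> to_nat_on K) has_sum (\<integral>\<omega>. (\<Sum>\<^sub>\<infinity>k\<in>K. f k \<omega>) \<partial>M)) K"
    using \<open>countable K\<close> by (subst (asm) has_sum_reindex) (auto simp: inj_on_to_nat_on)
  then have *: "((\<lambda>k. \<integral>\<omega>. f k \<omega> \<partial>M) has_sum (\<integral>\<omega>. (\<Sum>\<^sub>\<infinity>k\<in>K. f k \<omega>) \<partial>M)) K"
    using \<open>countable K\<close> by (rule_tac has_sum_cong[THEN iffD1]) (auto simp: h_def[abs_def])
  then show "(\<lambda>k. \<integral>\<omega>. f k \<omega> \<partial>M) summable_on K"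
    and "(\<Sum>\<^sub>\<infinity>k\<in>K. \<integral>\<omega>. f k \<omega> \<partial>M) = (\<integral>\<omega>. (\<Sum>\<^sub>\<infinity>k\<in>K. f k \<omega>) \<partial>M)"
    by (auto simp: summable_on_def intro: infsumI)
qed

lemma exp_minus_1_has_sum:
  fixes z :: "'a :: {banach, real_normed_field}"
  shows "((\<lambda>n. z ^ n / fact n) has_sum (exp z - 1)) {1..}"
    and "(\<lambda>n. norm (z ^ n / fact n)) summable_on {1..}"
proof -
  have s: "summable (\<lambda>n. norm (z ^ n / fact n))"
    using summable_norm_exp[of z] by (simp add: scaleR_conv_of_real field_simps)
  have "(\<lambda>n. z ^ n / fact n) sums exp z"
    using exp_converges[of z] by (simp add: scaleR_conv_of_real field_simps)
  from norm_summable_imp_has_sum[OF s this]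
  have "((\<lambda>n. z ^ n / fact n) has_sum (exp z - (\<Sum>n\<in>{0}. z ^ n / fact n))) (UNIV - {0})"
    by (intro has_sum_Diff has_sum_finite) auto
  moreover have "UNIV - {0 :: nat} = {1..}" by auto
  ultimately show "((\<lambda>n. z ^ n / fact n) has_sum (exp z - 1)) {1..}" by simp
  show "(\<lambda>n. norm (z ^ n / fact n)) summable_on {1..}"
    by (rule summable_on_subset_banach[of _ UNIV])
      (use s in \<open>auto intro: norm_summable_imp_summable_on\<close>)
qed

lemma prod_exp_minus_1_expansion:
  fixes z :: "'i \<Rightarrow> complex"
  assumes "finite I"
  shows "(\<Prod>i\<in>I. exp (z i) - 1) = (\<Sum>\<^sub>\<infinity>k\<in>I \<rightarrow>\<^sub>E {1..}. \<Prod>i\<in>I. z i ^ k i / fact (k i))"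
  using \<open>finite I\<close>
  by (subst infsum_prod_PiE_abs)
    (auto simp: exp_minus_1_has_sum(2)[simplified] infsumI[OF exp_minus_1_has_sum(1), simplified])

text \<open>The finite set \<open>F\<close> is enclosed in the box of its coordinate projections.
  Over a box the sum factors, and each factor is a partial sum of the exponential series without its
  constant term.\<close>

lemma sum_prod_exp_terms_le:
  fixes x :: "'i \<Rightarrow> real"
  assumes "finite I" "finite F" "F \<subseteq> I \<rightarrow>\<^sub>E {1..}" "\<And>i. i \<in> I \<Longrightarrow> 0 \<le> x i"
  shows "(\<Sum>k\<in>F. \<Prod>i\<in>I. x i ^ k i / fact (k i)) \<le> (\<Prod>i\<in>I. exp (x i) - 1)"
proof -
  define N where "N i = (\<lambda>k. k i) ` F" for i
  have "(\<Sum>k\<in>F. \<Prod>i\<in>I. x i ^ k i / fact (k i)) \<le> (\<Sum>k\<in>PiE I N. \<Prod>i\<in>I. x i ^ k i / fact (k i))"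
    using assms by (intro sum_mono2 finite_PiE prod_nonneg) (auto simp: N_def PiE_def)
  also have "\<dots> = (\<Prod>i\<in>I. \<Sum>n\<in>N i. x i ^ n / fact n)"
    using assms by (subst prod_sum_PiE) (auto simp: N_def)
  also have "\<dots> \<le> (\<Prod>i\<in>I. exp (x i) - 1)"
  proof (intro prod_mono conjI sum_nonneg)
    fix i assume i: "i \<in> I"
    show "(\<Sum>n\<in>N i. x i ^ n / fact n) \<le> exp (x i) - 1"
      using assms i by (intro finite_sum_le_has_sum[OF exp_minus_1_has_sum(1)])
        (auto simp: N_def)
  qed (use assms in auto)
  finally show ?thesis .
qed

lemma prod_exp_minus_1_le:
  fixes x :: "'i \<Rightarrow> real"
  assumes "finite I" "\<And>i. i \<in> I \<Longrightarrow> 0 \<le> x i"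
  shows "(\<Prod>i\<in>I. exp (x i) - 1) \<le> exp (\<Sum>i\<in>I. x i)"
  using assms by (auto simp: exp_sum intro!: prod_mono)

context prob_space
begin

text \<open>The coefficients \<open>p\<close> are the mixed moments divided by factorials. The
  expansion may be integrated termwise because
  \<open>exp (\<Sum>i\<in>I. norm (v i) * D i \<omega>)\<close> dominates all its partial sums and
  is integrable, being a real exponential moment.\<close>

lemma expectation_prod_exp_minus_1:
  fixes D :: "'i \<Rightarrow> 'a \<Rightarrow> real"
  assumes "finite I"
    and [measurable]: "\<And>i. i \<in> I \<Longrightarrow> random_variable borel (D i)"
    and nonneg: "\<And>i \<omega>. i \<in> I \<Longrightarrow> \<omega> \<in> space M \<Longrightarrow> 0 \<le> D i \<omega>"
    and int: "\<And>u :: 'i \<Rightarrow> real. integrable M (\<lambda>\<omega>. exp (\<Sum>i\<in>I. u i * D i \<omega>))"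
  defines "p \<equiv> \<lambda>k. complex_of_real (expectation (\<lambda>\<omega>. \<Prod>i\<in>I. D i \<omega> ^ k i / fact (k i)))"
  shows "(\<lambda>k. p k * (\<Prod>i\<in>I. v i ^ k i)) summable_on (I \<rightarrow>\<^sub>E {1..})"
    and "(\<Sum>\<^sub>\<infinity>k\<in>I \<rightarrow>\<^sub>E {1..}. p k * (\<Prod>i\<in>I. v i ^ k i)) =
      (\<integral>\<omega>. (\<Prod>i\<in>I. exp (v i * of_real (D i \<omega>)) - 1) \<partial>M)"
proof -
  define f where "f k \<omega> = (\<Prod>i\<in>I. (v i * of_real (D i \<omega>)) ^ k i / fact (k i))" for k \<omega>
  have [measurable]: "f k \<in> borel_measurable M" for k
    unfolding f_def by measurable
  have norm_f: "norm (f k \<omega>) = (\<Prod>i\<in>I. (norm (v i) * D i \<omega>) ^ k i / fact (k i))"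
    if "\<omega> \<in> space M" for k \<omega>
    unfolding f_def using nonneg that
    by (auto simp: prod_norm[symmetric] norm_mult norm_power norm_divide intro!: prod.cong)
  have dom: "(\<Sum>k\<in>F. norm (f k \<omega>)) \<le> exp (\<Sum>i\<in>I. norm (v i) * D i \<omega>)"
    if "\<omega> \<in> space M" "finite F" "F \<subseteq> I \<rightarrow>\<^sub>E {1..}" for \<omega> F
    unfolding norm_f[OF that(1)] using that nonneg
    by (intro order_trans[OF sum_prod_exp_terms_le prod_exp_minus_1_le] \<open>finite I\<close>) auto
  \<comment> \<open>A single term is the partial sum over \<open>{k}\<close>, so the same majorant
    applies.\<close>
  have int_f: "integrable M (f k)" if "k \<in> I \<rightarrow>\<^sub>E {1..}" for k
  proof (rule Bochner_Integration.integrable_bound[OF int])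
    show "AE \<omega> in M. norm (f k \<omega>) \<le> norm (exp (\<Sum>i\<in>I. norm (v i) * D i \<omega>))"
      using dom[of _ "{k}"] that by auto
  qed measurable
  have f: "(\<integral>\<omega>. f k \<omega> \<partial>M) = p k * (\<Prod>i\<in>I. v i ^ k i)" for k
  proof -
    have "f k \<omega> = of_real (\<Prod>i\<in>I. D i \<omega> ^ k i / fact (k i)) * (\<Prod>i\<in>I. v i ^ k i)" for \<omega>
      by (simp add: f_def power_mult_distrib prod_dividef prod.distrib)
    then show ?thesis by (simp add: p_def del: of_real_prod)
  qed
  have "countable (I \<rightarrow>\<^sub>E ({1..} :: nat set))"
    using \<open>finite I\<close> by (intro countable_PiE) auto
  note interchange = integral_infsum_interchange[OF this int_f int dom]
  show "(\<lambda>k. p k * (\<Prod>i\<in>I. v i ^ k i)) summable_on (I \<rightarrow>\<^sub>E {1..})"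
    using interchange(1) by (simp add: f)
  show "(\<Sum>\<^sub>\<infinity>k\<in>I \<rightarrow>\<^sub>E {1..}. p k * (\<Prod>i\<in>I. v i ^ k i)) =
      (\<integral>\<omega>. (\<Prod>i\<in>I. exp (v i * of_real (D i \<omega>)) - 1) \<partial>M)"
    using interchange(2) by (simp add: f) (simp add: f_def prod_exp_minus_1_expansion[OF \<open>finite I\<close>])
qed

end

section \<open>From real to complex exponential moments\<close>

lemma bij_betw_nth_smallest:
  assumes "finite C"
  shows "bij_betw (nth_smallest C) {1..card C} C"
proof -
  have 1: "bij_betw (\<lambda>i. i - 1) {1..card C} {..<card C}"
    by (rule bij_betw_byWitness[where f' = Suc]) auto
  have 2: "bij_betw ((!) (sorted_list_of_set C)) {..<card C} C"
    using assms by (intro bij_betw_nth) auto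
  show ?thesis
    using bij_betw_trans[OF 1 2] by (simp add: nth_smallest_def[abs_def] comp_def)
qed

lemma prod_nth_smallest:
  "finite C \<Longrightarrow> (\<Prod>j=1..card C. f (nth_smallest C j)) = (\<Prod>i\<in>C. f i)"
  using bij_betw_nth_smallest by (rule prod.reindex_bij_betw)

text \<open>A crude bound for dominating products over \<open>C\<close>: the factor 2 per index
  becomes \<open>2 ^ card C\<close>.\<close>

lemma norm_exp_minus_1_le: "norm (exp z - 1) \<le> 2 * exp (norm z)" for z :: complex
proof -
  have "norm (exp z - 1) \<le> norm (exp z) + 1"
    using norm_triangle_ineq4[of "exp z" 1] by (simp del: norm_exp_eq_Re)
  moreover note norm_exp[of z]
  moreover have "1 \<le> exp (norm z)" by simp
  ultimately show ?thesis by linarith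
qed

context prob_space
begin

text \<open>The coefficients \<open>c\<close> are arbitrary, so one proof serves both kinds of
  processes. The hypothesis equates only the totals over all \<open>C\<close>; these are first
  separated into one equality per \<open>C\<close> at real points, and each is then continued to
  complex points.\<close>

lemma exponential_moments_real_imp_complex:
  fixes D :: "nat \<Rightarrow> 'a \<Rightarrow> real" and c :: "nat set \<Rightarrow> (nat \<Rightarrow> nat) \<Rightarrow> complex"
  assumes [measurable]: "\<And>i. i \<in> {1..m} \<Longrightarrow> random_variable borel (D i)"
    and nonneg: "\<And>i \<omega>. i \<in> {1..m} \<Longrightarrow> \<omega> \<in> space M \<Longrightarrow> 0 \<le> D i \<omega>"
    and int: "\<And>u :: nat \<Rightarrow> real. integrable M (\<lambda>\<omega>. exp (\<Sum>i=1..m. u i * D i \<omega>))"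
    and eq: "\<And>u :: nat \<Rightarrow> real.
      of_real (expectation (\<lambda>\<omega>. exp (\<Sum>i=1..m. u i * D i \<omega>))) =
      1 + (\<Sum>C\<in>{C. C \<subseteq> {1..m} \<and> C \<noteq> {}}. \<Sum>\<^sub>\<infinity>k\<in>multi_indices C.
        c C k * (\<Prod>i=1..card C. of_real (u (nth_smallest C i)) ^ k i))"
  shows "(\<integral>\<omega>. exp (\<Sum>i=1..m. v i * of_real (D i \<omega>)) \<partial>M) =
      1 + (\<Sum>C\<in>{C. C \<subseteq> {1..m} \<and> C \<noteq> {}}. \<Sum>\<^sub>\<infinity>k\<in>multi_indices C.
        c C k * (\<Prod>i=1..card C. v (nth_smallest C i) ^ k i))"
proof -
  let ?S = "{C. C \<subseteq> {1..m} \<and> C \<noteq> {}}"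
  define H where "H C v = (\<integral>\<omega>. (\<Prod>i\<in>C. exp (v i * of_real (D i \<omega>)) - 1) \<partial>M)"
    for C and v :: "nat \<Rightarrow> complex"
  define R where "R C v = (\<Sum>\<^sub>\<infinity>k\<in>multi_indices C. c C k * (\<Prod>i=1..card C. v (nth_smallest C i) ^ k i))"
    for C and v :: "nat \<Rightarrow> complex"
  have fin: "finite C" if "C \<subseteq> {1..m}" for C
    using that by (rule finite_subset) simp
  have meas [measurable]: "i \<in> C \<Longrightarrow> random_variable borel (D i)" if "C \<subseteq> {1..m}" for i C
    using that by auto
  have int_C: "integrable M (\<lambda>\<omega>. exp (\<Sum>i\<in>C. u i * D i \<omega>))" if "C \<subseteq> {1..m}"
    for C and u :: "nat \<Rightarrow> real"
  proof -
    \<comment> \<open>Restricting the sum to \<open>C\<close> amounts to setting the other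
      parameters to 0.\<close>
    have "(\<Sum>i\<in>C. u i * D i \<omega>) = (\<Sum>i=1..m. (if i \<in> C then u i else 0) * D i \<omega>)" for \<omega>
      using that by (intro sum.mono_neutral_cong_left) auto
    then show ?thesis using int[of "\<lambda>i. if i \<in> C then u i else 0"] by simp
  qed
  have int_H: "integrable M (\<lambda>\<omega>. \<Prod>i\<in>C. exp (v i * of_real (D i \<omega>)) - 1)"
    if C: "C \<subseteq> {1..m}" for C and v :: "nat \<Rightarrow> complex"
  proof (rule Bochner_Integration.integrable_bound)
    show "integrable M (\<lambda>\<omega>. 2 ^ card C * exp (\<Sum>i\<in>C. norm (v i) * D i \<omega>))"
      using int_C[OF C] by (intro integrable_mult_right)
    have "norm (\<Prod>i\<in>C. exp (v i * of_real (D i \<omega>)) - 1) \<le>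
        2 ^ card C * exp (\<Sum>i\<in>C. norm (v i) * D i \<omega>)" if "\<omega> \<in> space M" for \<omega>
    proof -
      have "norm (\<Prod>i\<in>C. exp (v i * of_real (D i \<omega>)) - 1) \<le> (\<Prod>i\<in>C. 2 * exp (norm (v i) * D i \<omega>))"
        unfolding prod_norm[symmetric]
      proof (intro prod_mono conjI norm_ge_zero)
        fix i assume "i \<in> C"
        then have "0 \<le> D i \<omega>" using nonneg C that by auto
        then show "norm (exp (v i * of_real (D i \<omega>)) - 1) \<le> 2 * exp (norm (v i) * D i \<omega>)"
          using norm_exp_minus_1_le[of "v i * of_real (D i \<omega>)"] by (simp add: norm_mult)
      qed
      then show ?thesis using fin[OF C] by (simp add: prod.distrib exp_sum)
    qed
    then show "AE \<omega> in M. norm (\<Prod>i\<in>C. exp (v i * of_real (D i \<omega>)) - 1) \<le>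
        norm (2 ^ card C * exp (\<Sum>i\<in>C. norm (v i) * D i \<omega>))"
      by (intro AE_I2) simp
    show "(\<lambda>\<omega>. \<Prod>i\<in>C. exp (v i * of_real (D i \<omega>)) - 1) \<in> borel_measurable M"
      using meas[OF C] by measurable
  qed
  have expand: "(\<integral>\<omega>. exp (\<Sum>i=1..m. v i * of_real (D i \<omega>)) \<partial>M) = 1 + (\<Sum>C\<in>?S. H C v)"
    for v :: "nat \<Rightarrow> complex"
  proof -
    \<comment> \<open>Each factor is written as \<open>(exp z - 1) + 1\<close> and the product is
      expanded over subsets. The empty subset contributes the total mass 1.\<close>
    have "exp (\<Sum>i=1..m. v i * of_real (D i \<omega>)) =
        (\<Sum>C\<in>Pow {1..m}. \<Prod>i\<in>C. exp (v i * of_real (D i \<omega>)) - 1)" for \<omega>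
      using prod_add[of "{1..m}" "\<lambda>i. exp (v i * of_real (D i \<omega>)) - 1" "\<lambda>_. 1"]
      by (simp add: exp_sum)
    then have "(\<integral>\<omega>. exp (\<Sum>i=1..m. v i * of_real (D i \<omega>)) \<partial>M) = (\<Sum>C\<in>Pow {1..m}. H C v)"
      unfolding H_def using int_H by (subst Bochner_Integration.integral_sum[symmetric]) auto
    also have "Pow {1..m} = insert {} ?S" by auto
    also have "(\<Sum>C\<in>insert {} ?S. H C v) = 1 + (\<Sum>C\<in>?S. H C v)"
      by (subst sum.insert) (auto simp: H_def prob_space)
    finally show ?thesis .
  qed
  have H_vanish: "H C v = 0" if "C \<subseteq> {1..m}" "i \<in> C" "v i = 0" for C v i
  proof -
    have "(\<Prod>i\<in>C. exp (v i * of_real (D i \<omega>)) - 1) = 0" for \<omega>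
      using that fin[OF that(1)] by (intro prod_zero bexI[of _ i]) auto
    then show ?thesis by (simp add: H_def)
  qed
  have R_vanish: "R C v = 0" if C: "C \<subseteq> {1..m}" "i \<in> C" "v i = 0" for C v i
    unfolding R_def
  proof (rule infsum_0)
    fix k assume k: "k \<in> multi_indices C"
    obtain j where j: "j \<in> {1..card C}" "nth_smallest C j = i"
      using bij_betw_nth_smallest[OF fin[OF C(1)]] C(2) unfolding bij_betw_def by (metis imageE)
    then have "k j \<ge> 1" using k by (auto simp: multi_indices_def PiE_def Pi_def)
    then show "c C k * (\<Prod>i=1..card C. v (nth_smallest C i) ^ k i) = 0"
      using j C by (auto intro!: bexI[of _ j])
  qed
  have H_cong: "H C v = H C w" if "\<And>i. i \<in> C \<Longrightarrow> v i = w i" for C v w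
    using that by (simp add: H_def)
  have R_cong: "R C v = R C w" if "C \<subseteq> {1..m}" "\<And>i. i \<in> C \<Longrightarrow> v i = w i" for C v w
  proof -
    have "nth_smallest C j \<in> C" if "j \<in> {1..card C}" for j
      using bij_betw_nth_smallest[OF fin[OF \<open>C \<subseteq> {1..m}\<close>]] that by (auto simp: bij_betw_def)
    with that show ?thesis
      unfolding R_def by (intro infsum_cong) simp
  qed
  have real_eq: "H C (\<lambda>i. of_real (u i)) = R C (\<lambda>i. of_real (u i))" if "C \<in> ?S"
    for C and u :: "nat \<Rightarrow> real"
    using that
  proof (induction "card C" arbitrary: C rule: less_induct)
    case less
    \<comment> \<open>Zeroing the parameters outside \<open>C\<close> kills every summand not
      indexed by a subset of \<open>C\<close>. Proper subsets cancel by the induction hypothesis,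
      which leaves the equality for \<open>C\<close> alone.\<close>
    define u' where "u' i = (if i \<in> C then u i else 0)" for i
    let ?v = "\<lambda>i. complex_of_real (u i)" and ?w = "\<lambda>i. complex_of_real (u' i)"
    have "1 + (\<Sum>B\<in>?S. H B ?w) = of_real (expectation (\<lambda>\<omega>. exp (\<Sum>i=1..m. u' i * D i \<omega>)))"
      unfolding expand[symmetric] integral_complex_of_real[symmetric]
      by (intro Bochner_Integration.integral_cong) (auto simp: exp_of_real[symmetric])
    also have "\<dots> = 1 + (\<Sum>B\<in>?S. R B ?w)"
      unfolding R_def by (rule eq)
    finally have "(\<Sum>B\<in>?S. H B ?w - R B ?w) = 0"
      by (simp add: sum_subtractf)
    also have "(\<Sum>B\<in>?S. H B ?w - R B ?w) = (\<Sum>B\<in>{C}. H B ?w - R B ?w)"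
    proof (rule sum.mono_neutral_right)
      show "\<forall>B\<in>?S - {C}. H B ?w - R B ?w = 0"
      proof
        fix B assume B: "B \<in> ?S - {C}"
        show "H B ?w - R B ?w = 0"
        proof (cases "B \<subseteq> C")
          case True
          then have *: "u' i = u i" if "i \<in> B" for i
            using that by (auto simp: u'_def)
          from True B less.prems have "card B < card C"
            using fin by (intro psubset_card_mono) auto
          then have "H B ?v = R B ?v" using less.hyps B by blast
          moreover have "H B ?w = H B ?v" using * by (intro H_cong) auto
          moreover have "R B ?w = R B ?v" using * B by (intro R_cong) auto
          ultimately show ?thesis by simp
        next
          case False
          then obtain i where "i \<in> B" "i \<notin> C" by auto
          then have "i \<in> B" "?w i = 0" by (simp_all add: u'_def)
          then show ?thesis using H_vanish[of B i ?w] R_vanish[of B i ?w] B by auto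
        qed
      qed
    qed (use less.prems in auto)
    finally have "H C ?w = R C ?w" by simp
    moreover have "H C ?w = H C ?v" by (intro H_cong) (auto simp: u'_def)
    moreover have "R C ?w = R C ?v" using less.prems by (intro R_cong) (auto simp: u'_def)
    ultimately show ?case by simp
  qed
  have "H C v = R C v" if "C \<in> ?S" for C
  proof -
    \<comment> \<open>Relabels the elements of \<open>C\<close> by their ranks, the positions at
      which \<open>multi_indices C\<close> reads its exponents.\<close>
    define D' where "D' j = D (nth_smallest C j)" for j
    let ?J = "{1..card C}"
    have C: "C \<subseteq> {1..m}" using that by auto
    note bij = bij_betw_nth_smallest[OF fin[OF C]]
    have nth_in: "nth_smallest C j \<in> {1..m}" if "j \<in> ?J" for j
      using bij_betwE[OF bij] C that by blast
    have int': "integrable M (\<lambda>\<omega>. exp (\<Sum>j\<in>?J. u j * D' j \<omega>))" for u :: "nat \<Rightarrow> real"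
    proof -
      have "(\<Sum>i\<in>C. u (inv_into ?J (nth_smallest C) i) * D i \<omega>) = (\<Sum>j\<in>?J. u j * D' j \<omega>)" for \<omega>
        using bij by (subst sum.reindex_bij_betw[OF bij, symmetric])
          (auto simp: bij_betw_def D'_def intro!: sum.cong)
      then show ?thesis using int_C[OF C, of "\<lambda>i. u (inv_into ?J (nth_smallest C) i)"] by simp
    qed
    have H: "(\<integral>\<omega>. (\<Prod>j\<in>?J. exp (w (nth_smallest C j) * of_real (D' j \<omega>)) - 1) \<partial>M) = H C w" for w
      unfolding H_def D'_def
      by (intro Bochner_Integration.integral_cong prod_nth_smallest fin[OF C] refl)
    define p where "p k = complex_of_real (expectation (\<lambda>\<omega>. \<Prod>i\<in>?J. D' i \<omega> ^ k i / fact (k i)))" for k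
    have p: "(\<lambda>k. p k * (\<Prod>i\<in>?J. w i ^ k i)) summable_on (?J \<rightarrow>\<^sub>E {1..})"
      "(\<Sum>\<^sub>\<infinity>k\<in>?J \<rightarrow>\<^sub>E {1..}. p k * (\<Prod>i\<in>?J. w i ^ k i)) =
        (\<integral>\<omega>. (\<Prod>i\<in>?J. exp (w i * of_real (D' i \<omega>)) - 1) \<partial>M)" for w
      unfolding p_def using expectation_prod_exp_minus_1[of ?J D' w] int' nth_in nonneg
      by (auto simp: D'_def)
    have "H C v = (\<Sum>\<^sub>\<infinity>k\<in>?J \<rightarrow>\<^sub>E {1..}. p k * (\<Prod>j\<in>?J. v (nth_smallest C j) ^ k j))"
      unfolding p(2) H ..
    also have "\<dots> = (\<Sum>\<^sub>\<infinity>k\<in>?J \<rightarrow>\<^sub>E {1..}. c C k * (\<Prod>j\<in>?J. v (nth_smallest C j) ^ k j))"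
    proof (rule multi_powser_real_imp_complex[OF _ p(1)])
      fix u :: "nat \<Rightarrow> real"
      \<comment> \<open>The tuple \<open>u\<close> is indexed by ranks; \<open>u'\<close> is the
        same tuple indexed by the elements of \<open>C\<close>, as \<open>real_eq\<close>
        expects.\<close>
      define u' where "u' i = u (inv_into ?J (nth_smallest C) i)" for i
      have u': "u' (nth_smallest C j) = u j" if "j \<in> ?J" for j
        using bij that by (auto simp: bij_betw_def u'_def)
      have "(\<Sum>\<^sub>\<infinity>k\<in>?J \<rightarrow>\<^sub>E {1..}. p k * (\<Prod>j\<in>?J. of_real (u j) ^ k j)) = H C (\<lambda>i. of_real (u' i))"
        unfolding p(2) H[symmetric]
        by (intro Bochner_Integration.integral_cong refl prod.cong) (simp add: u')
      also have "\<dots> = R C (\<lambda>i. of_real (u' i))"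
        by (rule real_eq[OF that])
      also have "\<dots> = (\<Sum>\<^sub>\<infinity>k\<in>?J \<rightarrow>\<^sub>E {1..}. c C k * (\<Prod>j\<in>?J. of_real (u j) ^ k j))"
        unfolding R_def multi_indices_def
        by (intro infsum_cong arg_cong2[of _ _ _ _ "(*)"] refl prod.cong) (simp add: u')
      finally show "(\<Sum>\<^sub>\<infinity>k\<in>?J \<rightarrow>\<^sub>E {1..}. p k * (\<Prod>j\<in>?J. of_real (u j) ^ k j)) =
          (\<Sum>\<^sub>\<infinity>k\<in>?J \<rightarrow>\<^sub>E {1..}. c C k * (\<Prod>j\<in>?J. of_real (u j) ^ k j))" .
    qed simp
    finally show ?thesis by (simp add: R_def multi_indices_def)
  qed
  then have "(\<Sum>C\<in>?S. H C v) = (\<Sum>C\<in>?S. R C v)" by (intro sum.cong refl)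
  then show ?thesis by (simp only: expand R_def)
qed

end

section \<open>Characteristic functions of the subordinated process\<close>

text \<open>Abel summation, turning values of a process into increments weighted by tail sums. The
  boundary term stays because the processes vanish at time 0 only almost surely.\<close>

lemma sum_by_parts_tails:
  fixes s y :: "nat \<Rightarrow> 'a :: comm_ring"
  shows "(\<Sum>j=1..m. s j * y j) =
    (\<Sum>i=1..m. (\<Sum>j=i..m. s j) * (y i - y (i - 1))) + (\<Sum>j=1..m. s j) * y 0"
proof (induction m)
  case 0
  then show ?case by simp
next
  case (Suc m)
  have "(\<Sum>i=1..Suc m. (\<Sum>j=i..Suc m. s j) * (y i - y (i - 1))) =
      (\<Sum>i=1..Suc m. (\<Sum>j=i..m. s j) * (y i - y (i - 1)) + s (Suc m) * (y i - y (i - 1)))"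
    by (intro sum.cong) (auto simp: algebra_simps)
  also have "\<dots> = (\<Sum>i=1..m. (\<Sum>j=i..m. s j) * (y i - y (i - 1))) +
      s (Suc m) * (\<Sum>i=1..Suc m. y i - y (i - 1))"
    by (simp add: sum.distrib sum_distrib_left distrib_left)
  also have "(\<Sum>i=1..Suc m. y i - y (i - 1)) = y (Suc m) - y 0"
    using sum_telescope''[of 0 "Suc m" y] by (simp add: atLeastSucAtMost_greaterThanAtMost)
  finally show ?case using Suc by (simp add: algebra_simps)
qed

section \<open>Rounding random times to a grid\<close>

text \<open>Exceeds \<open>z\<close> strictly for \<open>j \<ge> 1\<close>; the summand \<open>j\<close> makes the approximations of a
  nondecreasing sequence of times strictly increasing, as the independence of increments requires.\<close>

definition grid_time :: "nat \<Rightarrow> nat \<Rightarrow> real \<Rightarrow> real" where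
  "grid_time n j z = (real (nat \<lfloor>real (Suc n) * z\<rfloor>) + real j) / real (Suc n)"

lemma grid_time_nonneg: "0 \<le> grid_time n j z"
  by (simp add: grid_time_def)

lemma grid_time_0 [simp]: "grid_time n 0 0 = 0"
  by (simp add: grid_time_def)

lemma grid_time_strict_mono:
  assumes "i < j" "x \<le> y"
  shows "grid_time n i x < grid_time n j y"
proof -
  have "nat \<lfloor>real (Suc n) * x\<rfloor> \<le> nat \<lfloor>real (Suc n) * y\<rfloor>"
    using assms by (intro nat_mono floor_mono mult_left_mono) auto
  then show ?thesis
    using assms by (simp add: grid_time_def divide_strict_right_mono)
qed

lemma grid_time_bounds:
  assumes "0 \<le> z"
  shows "z + (real j - 1) / real (Suc n) < grid_time n j z"
    and "grid_time n j z \<le> z + real j / real (Suc n)"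
proof -
  have "real (nat \<lfloor>real (Suc n) * z\<rfloor>) = of_int \<lfloor>real (Suc n) * z\<rfloor>"
    using assms by (intro of_nat_nat) simp
  moreover have "real (Suc n) * z - 1 < of_int \<lfloor>real (Suc n) * z\<rfloor>"
      "of_int \<lfloor>real (Suc n) * z\<rfloor> \<le> real (Suc n) * z"
    by linarith+
  moreover have "z + a / real (Suc n) = (real (Suc n) * z + a) / real (Suc n)" for a
    by (simp add: add_divide_distrib)
  ultimately show "z + (real j - 1) / real (Suc n) < grid_time n j z"
    and "grid_time n j z \<le> z + real j / real (Suc n)"
    unfolding grid_time_def by (auto intro!: divide_strict_right_mono divide_right_mono)
qed

lemma grid_time_tendsto:
  assumes "0 \<le> z"
  shows "(\<lambda>n. grid_time n j z) \<longlonglongrightarrow> z"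
proof (rule tendsto_sandwich)
  have lim: "(\<lambda>n. z + a / real (Suc n)) \<longlonglongrightarrow> z" for a
    using tendsto_add[OF tendsto_const[of z] LIMSEQ_Suc[OF lim_const_over_n[of a]]] by simp
  show "(\<lambda>n. z + (real j - 1) / real (Suc n)) \<longlonglongrightarrow> z" "(\<lambda>n. z + real j / real (Suc n)) \<longlonglongrightarrow> z"
    by (rule lim)+
qed (use grid_time_bounds[OF assms] in \<open>auto intro!: always_eventually less_imp_le\<close>)

text \<open>Right-continuous paths call for convergence from strictly above. At \<open>j = 0\<close>
  the rounding goes downwards, hence the condition on \<open>j\<close>.\<close>

lemma grid_time_at_right:
  assumes "0 \<le> z" "1 \<le> j"
  shows "filterlim (\<lambda>n. grid_time n j z) (at_right z) sequentially"
proof -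
  have "z < grid_time n j z" for n
  proof -
    have "0 \<le> (real j - 1) / real (Suc n)" using assms by simp
    then show ?thesis using grid_time_bounds(1)[OF assms(1), of j n] by linarith
  qed
  then show ?thesis
    using grid_time_tendsto[OF assms(1)] by (auto simp: filterlim_at less_imp_neq[symmetric])
qed

lemma borel_measurable_grid_time [measurable]: "grid_time n j \<in> borel_measurable borel"
  unfolding grid_time_def[abs_def] by measurable

text \<open>A rounded time takes countably many values, and evaluation of \<open>y\<close> at each
  fixed value is a coordinate projection.\<close>

lemma measurable_eval_grid_time:
  assumes "\<tau> \<in> I"
  shows "(\<lambda>(x, y). y (grid_time n j (x \<tau>))) \<in>
    borel_measurable (PiM I (\<lambda>_. borel :: real measure) \<Otimes>\<^sub>M PiM {0..} (\<lambda>_. borel :: real measure))"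
proof -
  let ?P = "PiM I (\<lambda>_. borel :: real measure) \<Otimes>\<^sub>M PiM {0..} (\<lambda>_. borel :: real measure)"
  have [measurable]: "(\<lambda>x. x \<tau>) \<in> borel_measurable (PiM I (\<lambda>_. borel :: real measure))"
    using assms by (rule measurable_component_singleton)
  have "(\<lambda>p. snd p ((real k + real j) / real (Suc n))) \<in> borel_measurable ?P" for k
  proof -
    have "(\<lambda>y. y ((real k + real j) / real (Suc n))) \<in> borel_measurable (PiM {0..} (\<lambda>_. borel :: real measure))"
      by (rule measurable_component_singleton) simp
    then show ?thesis by measurable
  qed
  moreover have "(\<lambda>p. nat \<lfloor>real (Suc n) * fst p \<tau>\<rfloor>) \<in> measurable ?P (count_space UNIV)"
    by measurable
  ultimately show ?thesis
    unfolding grid_time_def case_prod_unfold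
    by (rule measurable_compose_countable[where f = "\<lambda>k p. snd p ((real k + real j) / real (Suc n))"])
qed

section \<open>Levy processes at deterministic and at random times\<close>

context prob_space
begin

text \<open>Abel summation rewrites the exponent in increments of \<open>Y\<close>; independence
  factors the expectation, and stationarity evaluates each factor.\<close>

lemma levy_process_char_fidi:
  fixes m :: nat and r :: "nat \<Rightarrow> real"
  assumes levy: "levy_process Y"
    and char: "\<And>t s. t \<ge> 0 \<Longrightarrow> char (distr M borel (Y t)) s = exp (of_real t * \<psi> s)"
    and r0: "r 0 = 0" and mono: "strict_mono_on {0..m} r"
  shows "(\<integral>\<omega>. iexp (\<Sum>j=1..m. s j * Y (r j) \<omega>) \<partial>M) =
    exp (\<Sum>i=1..m. \<psi> (\<Sum>j=i..m. s j) * of_real (r i - r (i - 1)))"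
proof -
  define S where "S i = (\<Sum>j=i..m. s j)" for i
  have le: "r i \<le> r j" if "i \<le> j" "j \<le> m" for i j
    using strict_mono_on_leD[OF mono] that by auto
  have meas [measurable]: "random_variable borel (Y (r i))" if "i \<le> m" for i
    using levy le[of 0 i] that by (auto simp: levy_process_def r0)
  have AE0: "AE \<omega> in M. Y (r 0) \<omega> = 0"
    using levy by (simp add: levy_process_def r0)
  have indep: "indep_vars (\<lambda>_. borel) (\<lambda>i \<omega>. Y (r (Suc i)) \<omega> - Y (r i) \<omega>) {..<m}"
    using levy mono by (simp add: levy_process_def r0)
  let ?E = "\<lambda>i x. iexp (S (Suc i) * x)"
  have "(\<integral>\<omega>. iexp (\<Sum>j=1..m. s j * Y (r j) \<omega>) \<partial>M) =
      (\<integral>\<omega>. (\<Prod>i<m. ?E i (Y (r (Suc i)) \<omega> - Y (r i) \<omega>)) \<partial>M)"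
  proof (rule integral_cong_AE)
    show "AE \<omega> in M. iexp (\<Sum>j=1..m. s j * Y (r j) \<omega>) =
        (\<Prod>i<m. ?E i (Y (r (Suc i)) \<omega> - Y (r i) \<omega>))"
      using AE0
    proof eventually_elim
      case (elim \<omega>)
      have "(\<Sum>j=1..m. s j * Y (r j) \<omega>) = (\<Sum>i=1..m. S i * (Y (r i) \<omega> - Y (r (i - 1)) \<omega>))"
        using sum_by_parts_tails[of s "\<lambda>j. Y (r j) \<omega>" m] elim by (simp add: S_def)
      also have "\<dots> = (\<Sum>i<m. S (Suc i) * (Y (r (Suc i)) \<omega> - Y (r i) \<omega>))"
        by (simp add: sum.atLeast1_atMost_eq)
      finally show ?case by (simp add: exp_sum[symmetric] sum_distrib_left)
    qed
  qed measurable
  also have "\<dots> = (\<Prod>i<m. \<integral>\<omega>. ?E i (Y (r (Suc i)) \<omega> - Y (r i) \<omega>) \<partial>M)"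
  proof (rule indep_vars_lebesgue_integral)
    show "indep_vars (\<lambda>_. borel) (\<lambda>i \<omega>. ?E i (Y (r (Suc i)) \<omega> - Y (r i) \<omega>)) {..<m}"
      by (rule indep_vars_compose2[OF indep]) measurable
    show "integrable M (\<lambda>\<omega>. ?E i (Y (r (Suc i)) \<omega> - Y (r i) \<omega>))" if "i \<in> {..<m}" for i
      using that by (intro integrable_iexp) auto
  qed simp
  also have "\<dots> = (\<Prod>i<m. exp (\<psi> (S (Suc i)) * of_real (r (Suc i) - r i)))"
  proof (rule prod.cong)
    fix i assume "i \<in> {..<m}"
    then have i: "i < m" by simp
    have h: "0 \<le> r i" "0 \<le> r (Suc i) - r i"
      using le[of 0 i] le[of i "Suc i"] i by (auto simp: r0)
    have "(\<integral>\<omega>. ?E i (Y (r (Suc i)) \<omega> - Y (r i) \<omega>) \<partial>M) =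
        char (distr M borel (\<lambda>\<omega>. Y (r i + (r (Suc i) - r i)) \<omega> - Y (r i) \<omega>)) (S (Suc i))"
      unfolding char_def using i by (subst integral_distr) auto
    also have "\<dots> = char (distr M borel (Y (r (Suc i) - r i))) (S (Suc i))"
      using levy h unfolding levy_process_def by metis
    finally show "(\<integral>\<omega>. ?E i (Y (r (Suc i)) \<omega> - Y (r i) \<omega>) \<partial>M) =
        exp (\<psi> (S (Suc i)) * of_real (r (Suc i) - r i))"
      using char[OF h(2)] by (simp add: mult.commute)
  qed simp
  also have "\<dots> = exp (\<Sum>i=1..m. \<psi> (S i) * of_real (r i - r (i - 1)))"
    by (simp add: exp_sum sum.atLeast1_atMost_eq)
  finally show ?thesis by (simp add: S_def)
qed

text \<open>A characteristic function is bounded by 1 in modulus, and the modulus of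
  \<open>exp (\<psi> s)\<close> is \<open>exp (Re (\<psi> s))\<close>. This later supplies the
  constant majorant 1.\<close>

lemma char_exponent_Re_nonpos:
  assumes "random_variable borel (Y 1)" "char (distr M borel (Y 1)) s = exp (\<psi> s)"
  shows "Re (\<psi> s) \<le> 0"
proof -
  interpret D: real_distribution "distr M borel (Y 1)"
    using assms(1) by (rule real_distribution_distr)
  show ?thesis using D.cmod_char_le_1[of s] assms(2) by simp
qed

text \<open>Since \<open>X\<close> is monotone only almost surely, \<open>max 0\<close> alters the
  increments on a null set; it makes them nonnegative at every point, as the passage to complex
  exponents demands.\<close>

lemma subordinated_char_fidi:
  assumes levy: "levy_process Y"
    and char: "\<And>t s. t \<ge> 0 \<Longrightarrow> char (distr M borel (Y t)) s = exp (of_real t * \<psi> s)"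
    and X: "time_change I X" and indep: "indep_processes I X {0..} Y"
    and t: "time_points m t" "t ` {0..m} \<subseteq> I"
  shows "(\<integral>\<omega>. iexp (\<Sum>j=1..m. s j * subordinated Y X (t j) \<omega>) \<partial>M) =
    (\<integral>\<omega>. exp (\<Sum>i=1..m. \<psi> (\<Sum>j=i..m. s j) *
      of_real (max 0 (X (t i) \<omega> - X (t (i - 1)) \<omega>))) \<partial>M)"
proof -
  define PX PY where "PX = PiM I (\<lambda>_. borel :: real measure)"
    and "PY = PiM {0 :: real..} (\<lambda>_. borel :: real measure)"
  define X' Y' where "X' \<omega> = (\<lambda>t\<in>I. X t \<omega>)" and "Y' \<omega> = (\<lambda>t\<in>{0..}. Y t \<omega>)" for \<omega>
  define S where "S i = (\<Sum>j=i..m. s j)" for i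
  \<comment> \<open>A functional of a pair of paths with the times already rounded, and therefore
    jointly measurable.\<close>
  define G where "G n = (\<lambda>(x, y). iexp (\<Sum>j=1..m. s j * y (grid_time n j (x (t j)))))"
    for n and x y :: "real \<Rightarrow> real"
  define Z where "Z n \<omega> = (\<Sum>i=1..m. \<psi> (S i) *
    of_real (grid_time n i (X (t i) \<omega>) - grid_time n (i - 1) (X (t (i - 1)) \<omega>)))" for n \<omega>
  have tI: "t j \<in> I" if "j \<le> m" for j using t(2) that by auto
  have X_meas [measurable]: "random_variable borel (X (t j))" if "j \<le> m" for j
    using X tI[OF that] by (auto simp: time_change_def)
  have X_nonneg: "0 \<le> X (t j) \<omega>" if "j \<le> m" "\<omega> \<in> space M" for j \<omega>
    using X tI[of j] that by (auto simp: time_change_def)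
  have AE_mono: "AE \<omega> in M. X (t 0) \<omega> = 0 \<and> (\<forall>i\<in>{0..m}. \<forall>j\<in>{i..m}. X (t i) \<omega> \<le> X (t j) \<omega>)"
  proof -
    have "t i \<le> t j" if "i \<le> j" "j \<le> m" for i j
      using t(1) that strict_mono_on_leD[of "{0..m}" t i j] by (auto simp: time_points_def)
    then have "AE \<omega> in M. X (t i) \<omega> \<le> X (t j) \<omega>" if "i \<in> {0..m}" "j \<in> {i..m}" for i j
      using X tI[of i] tI[of j] that by (auto simp: time_change_def)
    then have "AE \<omega> in M. \<forall>i\<in>{0..m}. \<forall>j\<in>{i..m}. X (t i) \<omega> \<le> X (t j) \<omega>"
      by (auto simp: AE_ball_countable)
    moreover have "AE \<omega> in M. X (t 0) \<omega> = 0"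
      using X t(1) by (auto simp: time_change_def time_points_def)
    ultimately show ?thesis by eventually_elim auto
  qed
  \<comment> \<open>Independence is used in the form that the joint law of the two paths is the
    product of their laws.\<close>
  have rv [measurable]: "X' \<in> measurable M PX" "Y' \<in> measurable M PY"
    and prod: "distr M PX X' \<Otimes>\<^sub>M distr M PY Y' = distr M (PX \<Otimes>\<^sub>M PY) (\<lambda>\<omega>. (X' \<omega>, Y' \<omega>))"
    using indep unfolding indep_processes_def indep_var_distribution_eq
    by (simp_all add: PX_def PY_def X'_def[abs_def] Y'_def[abs_def])
  interpret DX: prob_space "distr M PX X'" by (rule prob_space_distr) measurable
  interpret DY: prob_space "distr M PY Y'" by (rule prob_space_distr) measurable
  interpret P: pair_prob_space "distr M PX X'" "distr M PY Y'" ..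
  have G_meas [measurable]: "G n \<in> borel_measurable (PX \<Otimes>\<^sub>M PY)" for n
  proof -
    have [measurable]: "(\<lambda>(x, y). y (grid_time n j (x (t j)))) \<in> borel_measurable (PX \<Otimes>\<^sub>M PY)"
      if "j \<in> {1..m}" for j
      unfolding PX_def PY_def using tI[of j] that by (intro measurable_eval_grid_time) auto
    then show ?thesis
      unfolding G_def case_prod_unfold by measurable
  qed
  have G_norm: "norm (G n p) = 1" for n p
    by (simp add: G_def case_prod_unfold)
  \<comment> \<open>The restrictions in \<open>X'\<close> and \<open>Y'\<close> are invisible here:
    the points \<open>t j\<close> lie in \<open>I\<close> and grid times are nonnegative.\<close>
  have G_XY: "G n (X' \<omega>, Y' \<omega>') = iexp (\<Sum>j=1..m. s j * Y (grid_time n j (X (t j) \<omega>)) \<omega>')" for n \<omega> \<omega>'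
    using tI by (auto simp: G_def X'_def Y'_def grid_time_nonneg intro!: sum.cong)
  have grid_eq: "(\<integral>\<omega>. G n (X' \<omega>, Y' \<omega>) \<partial>M) = (\<integral>\<omega>. exp (Z n \<omega>) \<partial>M)" for n
  proof -
    have "(\<integral>\<omega>. G n (X' \<omega>, Y' \<omega>) \<partial>M) = (\<integral>p. G n p \<partial>(distr M PX X' \<Otimes>\<^sub>M distr M PY Y'))"
      unfolding prod by (subst integral_distr) auto
    also have "\<dots> = (\<integral>x. (\<integral>y. G n (x, y) \<partial>distr M PY Y') \<partial>distr M PX X')"
    proof (rule P.integral_fst'[symmetric])
      show "integrable (distr M PX X' \<Otimes>\<^sub>M distr M PY Y') (G n)"
        by (rule P.integrable_const_bound[of _ 1]) (auto simp: G_norm)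
    qed
    also have "\<dots> = (\<integral>\<omega>. (\<integral>y. G n (X' \<omega>, y) \<partial>distr M PY Y') \<partial>M)"
      by (subst integral_distr) auto
    also have "\<dots> = (\<integral>\<omega>. exp (Z n \<omega>) \<partial>M)"
    proof (rule integral_cong_AE)
      show "AE \<omega> in M. (\<integral>y. G n (X' \<omega>, y) \<partial>distr M PY Y') = exp (Z n \<omega>)"
        using AE_mono AE_space
      proof eventually_elim
        case (elim \<omega>)
        have "X' \<omega> \<in> space PX" using elim measurable_space[OF rv(1)] by blast
        then have [measurable]: "(\<lambda>y. G n (X' \<omega>, y)) \<in> borel_measurable PY"
          by measurable
        have "(\<integral>y. G n (X' \<omega>, y) \<partial>distr M PY Y') = (\<integral>\<omega>'. G n (X' \<omega>, Y' \<omega>') \<partial>M)"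
          by (subst integral_distr) auto
        \<comment> \<open>With \<open>\<omega>\<close> fixed, the rounded times start at 0 and
          increase strictly, so the formula for deterministic times applies.\<close>
        also have "\<dots> = exp (Z n \<omega>)"
          unfolding G_XY Z_def S_def
        proof (rule levy_process_char_fidi[OF levy char, where r = "\<lambda>j. grid_time n j (X (t j) \<omega>)"])
          show "strict_mono_on {0..m} (\<lambda>j. grid_time n j (X (t j) \<omega>))"
            using elim by (intro strict_mono_onI grid_time_strict_mono) auto
        qed (use elim in auto)
        finally show ?case .
      qed
      show "(\<lambda>\<omega>. exp (Z n \<omega>)) \<in> borel_measurable M"
      proof -
        have [measurable]: "random_variable borel (X (t i))" "random_variable borel (X (t (i - 1)))"
          if "i \<in> {1..m}" for i using that by (auto intro: X_meas)
        show ?thesis unfolding Z_def by measurable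
      qed
    qed measurable
    finally show ?thesis .
  qed
  have "(\<lambda>n. \<integral>\<omega>. G n (X' \<omega>, Y' \<omega>) \<partial>M) \<longlonglongrightarrow>
      (\<integral>\<omega>. iexp (\<Sum>j=1..m. s j * subordinated Y X (t j) \<omega>) \<partial>M)"
  proof (rule integral_dominated_convergence[where w = "\<lambda>_. 1"])
    \<comment> \<open>This holds at every \<open>\<omega>\<close>, not just almost surely, and so
      also shows that the subordinated integrand is measurable.\<close>
    have lim: "(\<lambda>n. G n (X' \<omega>, Y' \<omega>)) \<longlonglongrightarrow> iexp (\<Sum>j=1..m. s j * subordinated Y X (t j) \<omega>)"
      if \<omega>: "\<omega> \<in> space M" for \<omega>
      unfolding G_XY subordinated_def
    proof (intro tendsto_intros)
      fix j assume j: "j \<in> {1..m}"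
      have x: "0 \<le> X (t j) \<omega>" using X_nonneg j \<omega> by auto
      then have "((\<lambda>r. Y r \<omega>) \<longlongrightarrow> Y (X (t j) \<omega>) \<omega>) (at_right (X (t j) \<omega>))"
        using levy \<omega> by (auto simp: levy_process_def continuous_within)
      then show "(\<lambda>n. Y (grid_time n j (X (t j) \<omega>)) \<omega>) \<longlonglongrightarrow> Y (X (t j) \<omega>) \<omega>"
        by (rule filterlim_compose) (use x j in \<open>auto intro: grid_time_at_right\<close>)
    qed
    then show "AE \<omega> in M. (\<lambda>n. G n (X' \<omega>, Y' \<omega>)) \<longlonglongrightarrow>
        iexp (\<Sum>j=1..m. s j * subordinated Y X (t j) \<omega>)"
      by (rule AE_I2)
    show "(\<lambda>\<omega>. iexp (\<Sum>j=1..m. s j * subordinated Y X (t j) \<omega>)) \<in> borel_measurable M"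
      by (rule borel_measurable_LIMSEQ_metric[OF _ lim]) measurable
  qed (auto simp: G_norm)
  moreover have "(\<lambda>n. \<integral>\<omega>. exp (Z n \<omega>) \<partial>M) \<longlonglongrightarrow>
      (\<integral>\<omega>. exp (\<Sum>i=1..m. \<psi> (S i) * of_real (max 0 (X (t i) \<omega> - X (t (i - 1)) \<omega>))) \<partial>M)"
  proof (rule integral_dominated_convergence[where w = "\<lambda>_. 1"])
    have [measurable]: "random_variable borel (X (t i))" "random_variable borel (X (t (i - 1)))"
      if "i \<in> {1..m}" for i using that by (auto intro: X_meas)
    show "(\<lambda>\<omega>. exp (Z n \<omega>)) \<in> borel_measurable M" for n
      unfolding Z_def by measurable
    show "(\<lambda>\<omega>. exp (\<Sum>i=1..m. \<psi> (S i) * of_real (max 0 (X (t i) \<omega> - X (t (i - 1)) \<omega>))))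
        \<in> borel_measurable M"
      by measurable
    show "AE \<omega> in M. (\<lambda>n. exp (Z n \<omega>)) \<longlonglongrightarrow>
        exp (\<Sum>i=1..m. \<psi> (S i) * of_real (max 0 (X (t i) \<omega> - X (t (i - 1)) \<omega>)))"
      using AE_mono AE_space
    proof eventually_elim
      case (elim \<omega>)
      show ?case unfolding Z_def
      proof (intro tendsto_intros)
        fix i assume i: "i \<in> {1..m}"
        then have "X (t (i - 1)) \<omega> \<le> X (t i) \<omega>" using elim by auto
        then have "max 0 (X (t i) \<omega> - X (t (i - 1)) \<omega>) = X (t i) \<omega> - X (t (i - 1)) \<omega>" by simp
        moreover have "(\<lambda>n. grid_time n i (X (t i) \<omega>) - grid_time n (i - 1) (X (t (i - 1)) \<omega>))
            \<longlonglongrightarrow> X (t i) \<omega> - X (t (i - 1)) \<omega>"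
          using i elim by (intro tendsto_diff grid_time_tendsto X_nonneg) auto
        ultimately show "(\<lambda>n. grid_time n i (X (t i) \<omega>) - grid_time n (i - 1) (X (t (i - 1)) \<omega>))
            \<longlonglongrightarrow> max 0 (X (t i) \<omega> - X (t (i - 1)) \<omega>)" by simp
      qed
    qed
    have Re_psi: "Re (\<psi> a) \<le> 0" for a
      using levy char[of 1 a] by (intro char_exponent_Re_nonpos[of Y]) (auto simp: levy_process_def)
    \<comment> \<open>Almost surely the rounded increments are positive, and
      \<open>Re (\<psi> a)\<close> is nonpositive.\<close>
    show "AE \<omega> in M. norm (exp (Z n \<omega>)) \<le> 1" for n
      using AE_mono
    proof eventually_elim
      case (elim \<omega>)
      have "Re (\<psi> (S i)) * (grid_time n i (X (t i) \<omega>) - grid_time n (i - 1) (X (t (i - 1)) \<omega>)) \<le> 0"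
        if "i \<in> {1..m}" for i
        using grid_time_strict_mono[of "i - 1" i "X (t (i - 1)) \<omega>" "X (t i) \<omega>" n] that elim
        by (intro mult_nonpos_nonneg Re_psi) auto
      then have "Re (Z n \<omega>) \<le> 0"
        unfolding Z_def Re_sum by (intro sum_nonpos) (simp add: Re_complex_of_real)
      then show ?case by simp
    qed
  qed auto
  ultimately show ?thesis
    unfolding grid_eq S_def by (rule LIMSEQ_unique)
qed

end

section \<open>Subordination to EML processes\<close>

context prob_space
begin

text \<open>Combines conditioning on \<open>X\<close> with the passage to complex exponents, for
  arbitrary coefficients \<open>c\<close>, so that both processes become instances.\<close>

lemma subordinated_fidi_from_exponential_moments:
  fixes c :: "nat set \<Rightarrow> (nat \<Rightarrow> nat) \<Rightarrow> complex" and s :: "nat \<Rightarrow> real" and m :: nat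
  defines "F \<equiv> \<lambda>v :: nat \<Rightarrow> complex. 1 + (\<Sum>C\<in>{C. C \<subseteq> {1..m} \<and> C \<noteq> {}}. \<Sum>\<^sub>\<infinity>k\<in>multi_indices C.
        c C k * (\<Prod>i=1..card C. v (nth_smallest C i) ^ k i))"
  assumes levy: "levy_process Y"
    and char: "\<And>t s. t \<ge> 0 \<Longrightarrow> char (distr M borel (Y t)) s = exp (of_real t * \<psi> s)"
    and X: "time_change I X" and indep: "indep_processes I X {0..} Y"
    and t: "time_points m t" "t ` {0..m} \<subseteq> I"
    and int: "\<And>s. integrable M (\<lambda>\<omega>. exp (\<Sum>j=1..m. s j * X (t j) \<omega>))"
    and mom: "\<And>s. of_real (expectation (\<lambda>\<omega>. exp (\<Sum>j=1..m. s j * X (t j) \<omega>))) =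
      F (\<lambda>i. of_real (\<Sum>j=i..m. s j))"
  shows "(\<integral>\<omega>. iexp (\<Sum>j=1..m. s j * subordinated Y X (t j) \<omega>) \<partial>M) = F (\<lambda>i. \<psi> (\<Sum>j=i..m. s j))"
proof -
  define D where "D i \<omega> = max 0 (X (t i) \<omega> - X (t (i - 1)) \<omega>)" for i \<omega>
  have X_meas [measurable]: "random_variable borel (X (t i))" if "i \<le> m" for i
  proof -
    have "t i \<in> I" using t(2) that by auto
    then show ?thesis using X by (simp add: time_change_def)
  qed
  have D_meas [measurable]: "random_variable borel (D i)" if "i \<in> {1..m}" for i
  proof -
    have [measurable]: "random_variable borel (X (t i))" "random_variable borel (X (t (i - 1)))"
      using that by (auto intro: X_meas)
    show ?thesis unfolding D_def[abs_def] by measurable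
  qed
  have AE_D: "AE \<omega> in M. X (t 0) \<omega> = 0 \<and> (\<forall>i\<in>{1..m}. D i \<omega> = X (t i) \<omega> - X (t (i - 1)) \<omega>)"
  proof -
    have "AE \<omega> in M. D i \<omega> = X (t i) \<omega> - X (t (i - 1)) \<omega>" if "i \<in> {1..m}" for i
    proof -
      have "t (i - 1) \<le> t i"
        using t(1) that by (intro strict_mono_on_leD[of "{0..m}" t]) (auto simp: time_points_def)
      moreover have "t (i - 1) \<in> I" "t i \<in> I" using t(2) that by auto
      ultimately have "AE \<omega> in M. X (t (i - 1)) \<omega> \<le> X (t i) \<omega>"
        using X by (auto simp: time_change_def)
      then show ?thesis by eventually_elim (simp add: D_def)
    qed
    then have "AE \<omega> in M. \<forall>i\<in>{1..m}. D i \<omega> = X (t i) \<omega> - X (t (i - 1)) \<omega>"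
      by (auto simp: AE_ball_countable)
    moreover have "AE \<omega> in M. X (t 0) \<omega> = 0"
      using X t(1) by (auto simp: time_change_def time_points_def)
    ultimately show ?thesis by eventually_elim auto
  qed
  have real_case: "integrable M (\<lambda>\<omega>. exp (\<Sum>i=1..m. u i * D i \<omega>)) \<and>
      of_real (expectation (\<lambda>\<omega>. exp (\<Sum>i=1..m. u i * D i \<omega>))) = F (\<lambda>i. of_real (u i))"
    for u :: "nat \<Rightarrow> real"
  proof -
    \<comment> \<open>Inverts the map from weights to tail sums: with \<open>u'\<close> equal to 0
      beyond \<open>m\<close>, the differences \<open>s\<close> telescope back to \<open>u\<close>.
      Thus every real tuple \<open>u\<close> arises from a moment of \<open>X\<close>.\<close>
    define u' where "u' i = (if i \<le> m then u i else 0)" for i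
    define s where "s i = u' i - u' (Suc i)" for i
    have s: "(\<Sum>j=i..m. s j) = u i" if "i \<in> {1..m}" for i
    proof -
      have "(\<Sum>j=i..m. s j) = - (\<Sum>j=i..m. u' (Suc j) - u' j)"
        by (simp add: s_def sum_negf[symmetric])
      also have "\<dots> = u' i - u' (Suc m)"
        using that by (subst sum_Suc_diff) auto
      also have "\<dots> = u i" using that by (simp add: u'_def)
      finally show ?thesis .
    qed
    have AE_eq: "AE \<omega> in M. exp (\<Sum>j=1..m. s j * X (t j) \<omega>) = exp (\<Sum>i=1..m. u i * D i \<omega>)"
      using AE_D
    proof eventually_elim
      case (elim \<omega>)
      then show ?case
        using sum_by_parts_tails[of s "\<lambda>j. X (t j) \<omega>" m] s by simp
    qed
    have meas: "(\<lambda>\<omega>. exp (\<Sum>j=1..m. s j * X (t j) \<omega>)) \<in> borel_measurable M"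
      "(\<lambda>\<omega>. exp (\<Sum>i=1..m. u i * D i \<omega>)) \<in> borel_measurable M"
      by measurable
    \<comment> \<open>The two arguments agree on \<open>{1..m}\<close> only, and \<open>F\<close>
      reads its argument at elements of subsets of that range.\<close>
    have "F (\<lambda>i. of_real (\<Sum>j=i..m. s j)) = F (\<lambda>i. of_real (u i))"
    proof -
      have "nth_smallest C i \<in> {1..m}" if "C \<subseteq> {1..m}" "i \<in> {1..card C}" for C i
        using bij_betwE[OF bij_betw_nth_smallest[of C]] that finite_subset[of C] by blast
      then show ?thesis
        unfolding F_def using s
        by (intro arg_cong2[of _ _ _ _ "(+)"] sum.cong infsum_cong arg_cong2[of _ _ _ _ "(*)"] prod.cong refl) auto
    qed
    then show ?thesis
      using int[of s] mom[of s] integrable_cong_AE[OF meas AE_eq] integral_cong_AE[OF meas AE_eq]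
      by simp
  qed
  have "(\<integral>\<omega>. iexp (\<Sum>j=1..m. s j * subordinated Y X (t j) \<omega>) \<partial>M) =
      (\<integral>\<omega>. exp (\<Sum>i=1..m. \<psi> (\<Sum>j=i..m. s j) * of_real (D i \<omega>)) \<partial>M)"
    unfolding D_def by (rule subordinated_char_fidi[OF levy char X indep t])
  also have "\<dots> = F (\<lambda>i. \<psi> (\<Sum>j=i..m. s j))"
    unfolding F_def
  proof (rule exponential_moments_real_imp_complex)
    fix u :: "nat \<Rightarrow> real"
    show "integrable M (\<lambda>\<omega>. exp (\<Sum>i=1..m. u i * D i \<omega>))"
      "of_real (expectation (\<lambda>\<omega>. exp (\<Sum>i=1..m. u i * D i \<omega>))) =
        1 + (\<Sum>C\<in>{C. C \<subseteq> {1..m} \<and> C \<noteq> {}}. \<Sum>\<^sub>\<infinity>k\<in>multi_indices C.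
          c C k * (\<Prod>i=1..card C. of_real (u (nth_smallest C i)) ^ k i))"
      using real_case[of u] by (simp_all add: F_def)
  qed (use D_meas in \<open>auto simp: D_def\<close>)
  finally show ?thesis .
qed

end

theorem theorem4p1:
  fixes M :: "'a measure" and Y :: "real \<Rightarrow> 'a \<Rightarrow> real" and \<psi> :: "real \<Rightarrow> complex"
    and \<alpha> lam b T :: real
  assumes "prob_space M"
    and "T > 0" and "0 < \<alpha>" and "\<alpha> \<le> 1" and "lam > (\<alpha> - 1) / T" and "0 < b" and "b \<le> 1"
    and "prob_space.levy_process M Y"
    and "\<And>t s. t \<ge> 0 \<Longrightarrow> char (distr M borel (Y t)) s = exp (of_real t * \<psi> s)"
  shows
    "(\<forall>X :: real \<Rightarrow> 'a \<Rightarrow> real.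
        prob_space.EML M \<alpha> lam b T X \<and> prob_space.indep_processes M {0..T} X {0..} Y \<longrightarrow>
        (\<forall>m\<ge>1. \<forall>s t :: nat \<Rightarrow> real. time_points m t \<and> t m \<le> T \<longrightarrow>
           (\<integral>\<omega>. iexp (\<Sum>j=1..m. s j * subordinated Y X (t j) \<omega>) \<partial>M)
             = m_EML \<alpha> lam b T m (\<lambda>i. \<psi> (\<Sum>j=i..m. s j)) t)) \<and>
     (\<forall>Xs :: real \<Rightarrow> 'a \<Rightarrow> real.
        prob_space.EML_star M \<alpha> lam Xs \<and> prob_space.indep_processes M {0..} Xs {0..} Y \<longrightarrow>
        (\<forall>m\<ge>1. \<forall>s t :: nat \<Rightarrow> real. time_points m t \<longrightarrow>
           (\<integral>\<omega>. iexp (\<Sum>j=1..m. s j * subordinated Y Xs (t j) \<omega>) \<partial>M)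
             = m_EML_star \<alpha> lam m (\<lambda>i. \<psi> (\<Sum>j=i..m. s j)) t))"
proof -
  interpret prob_space M by fact
  have times: "0 \<le> t i \<and> t i \<le> t m" if "time_points m t" "i \<le> m" for t m i
    using that strict_mono_on_leD[of "{0..m}" t 0 i] strict_mono_on_leD[of "{0..m}" t i m]
    by (auto simp: time_points_def)
  \<comment> \<open>All factors free of \<open>v\<close> are collected into one coefficient. Moving
    the constant into the infinite sum is valid without summability, since \<open>infsum\<close> of
    a non-summable family is 0.\<close>
  have m_EML: "m_EML \<alpha> lam b T m v t =
      1 + (\<Sum>C\<in>{C. C \<subseteq> {1..m} \<and> C \<noteq> {}}. \<Sum>\<^sub>\<infinity>k\<in>multi_indices C.
        of_real (a_T \<alpha> lam b T * last_time t C powr (\<alpha> * (real (\<Sum>i=1..card C. k i) - 1) + 1) *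
          A_coeff \<alpha> lam t C k) * (\<Prod>i=1..card C. v (nth_smallest C i) ^ k i))" for m v t
    unfolding m_EML_def sum_distrib_left infsum_cmult_right'[symmetric] by (simp add: mult_ac)
  have m_EML_star: "m_EML_star \<alpha> lam m v t =
      1 + (\<Sum>C\<in>{C. C \<subseteq> {1..m} \<and> C \<noteq> {}}. \<Sum>\<^sub>\<infinity>k\<in>multi_indices C.
        of_real (last_time t C powr (\<alpha> * real (\<Sum>i=1..card C. k i)) * A_star_coeff \<alpha> lam t C k) *
        (\<Prod>i=1..card C. v (nth_smallest C i) ^ k i))" for m v t
    unfolding m_EML_star_def by (simp add: mult_ac)
  show ?thesis
  proof (intro conjI allI impI; elim conjE)
    fix X :: "real \<Rightarrow> 'a \<Rightarrow> real" and m :: nat and s t :: "nat \<Rightarrow> real"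
    assume X: "EML \<alpha> lam b T X" and indep: "indep_processes {0..T} X {0..} Y"
      and m: "m \<ge> 1" and t: "time_points m t" "t m \<le> T"
    have "t ` {0..m} \<subseteq> {0..T}" using times[OF t(1)] t(2) by fastforce
    moreover have "time_change {0..T} X" using X by (simp add: EML_def)
    moreover have "integrable M (\<lambda>\<omega>. exp (\<Sum>j=1..m. s j * X (t j) \<omega>))" for s
      using X m t unfolding EML_def by blast
    moreover have "of_real (expectation (\<lambda>\<omega>. exp (\<Sum>j=1..m. s j * X (t j) \<omega>))) =
        m_EML \<alpha> lam b T m (\<lambda>i. of_real (\<Sum>j=i..m. s j)) t" for s
      using X m t unfolding EML_def by blast
    ultimately show "(\<integral>\<omega>. iexp (\<Sum>j=1..m. s j * subordinated Y X (t j) \<omega>) \<partial>M)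
        = m_EML \<alpha> lam b T m (\<lambda>i. \<psi> (\<Sum>j=i..m. s j)) t"
      unfolding m_EML
      by (intro subordinated_fidi_from_exponential_moments[OF \<open>levy_process Y\<close> assms(9) _ indep t(1)])
  next
    fix X :: "real \<Rightarrow> 'a \<Rightarrow> real" and m :: nat and s t :: "nat \<Rightarrow> real"
    assume X: "EML_star \<alpha> lam X" and indep: "indep_processes {0..} X {0..} Y"
      and m: "m \<ge> 1" and t: "time_points m t"
    have "t ` {0..m} \<subseteq> {0..}" using times[OF t] by fastforce
    moreover have "time_change {0..} X" using X by (simp add: EML_star_def)
    moreover have "integrable M (\<lambda>\<omega>. exp (\<Sum>j=1..m. s j * X (t j) \<omega>))" for s
      using X m t unfolding EML_star_def by blast
    moreover have "of_real (expectation (\<lambda>\<omega>. exp (\<Sum>j=1..m. s j * X (t j) \<omega>))) =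
        m_EML_star \<alpha> lam m (\<lambda>i. of_real (\<Sum>j=i..m. s j)) t" for s
      using X m t unfolding EML_star_def by blast
    ultimately show "(\<integral>\<omega>. iexp (\<Sum>j=1..m. s j * subordinated Y X (t j) \<omega>) \<partial>M)
        = m_EML_star \<alpha> lam m (\<lambda>i. \<psi> (\<Sum>j=i..m. s j)) t"
      unfolding m_EML_star
      by (intro subordinated_fidi_from_exponential_moments[OF \<open>levy_process Y\<close> assms(9) _ indep t])
  qed
qed

end
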